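(* Let $R$ be a unique factorization domain, let $(p_1,p_2,Q_1,Q_2)\in L_2^{\mathrm{red}}(R)$ be a reduced quadruplet, and suppose that $F(x,y)=p_2y+Q_2(p_1x+Q_1(y))$ belongs to $\mathrm{VA}_2(R)$. Then: 1) $F$ is tame if and only if there exist $\sigma,\tau\in \mathrm{GA}_2(R)$ such that $\sigma(x),\sigma(y),\tau(x),\tau(y)\in \mathcal{B}^1(R)$ and $\sigma\tau(y)=F$. 2) $F$ has a mate of length $1$ if and only if $p_1p_2\in R^*$. 3) $F$ has length "$1+1$" if and only if $\phi_{p_1}(Q_1(y))\in \mathrm{VA}_1(R/p_1R)$. 4) If $F$ is tame or if $F$ has a mate of length $1$, then $F$ has length "$1+1$".
   Context: $R^*$ is the group of units of $R$, $R^{\times}=R\setminus\{0\}$, and $\mathrm{qt}(R)$ is the field of fractions of $R$. For a commutative ring $S$, $\mathrm{GA}_1(S)$ and $\mathrm{GA}_2(S)$ are the groups of automorphisms of the $S$-algebras $S[y]$ and $S[x,y]$; $\mathrm{VA}_1(S)=\{P\in S[y] : \exists \sigma\in \mathrm{GA}_1(S),\ \sigma(y)=P\}$, $\mathrm{VA}_2(S)=\{F\in S[x,y] : \exists \sigma\in \mathrm{GA}_2(S),\ \sigma(y)=F\}$. For $f_1,f_2\in R[x,y]$, $(f_1,f_2)$ denotes the $R$-algebra endomorphism $x\mapsto f_1$, $y\mapsto f_2$; $\sigma\tau(y)$ means $\sigma(\tau(y))$. For $p\in R$, $\phi_p$ is the canonical map $R\to R/pR$ extended coefficientwise to polynomials.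 $\mathcal{U}(R)\subset R^{\times}$ is a fixed set of representatives for the relation of association: every $r\in R^{\times}$ equals a unit times a unique element of $\mathcal{U}(R)$. $L_2(R)$ is the set of quadruplets $(p_1,p_2,Q_1,Q_2)$ with $p_1,p_2\in \mathrm{qt}(R)\setminus\{0\}$, $Q_1,Q_2\in \mathrm{qt}(R)[y]$, $\deg(Q_1)\ge 1$, $\deg(Q_2)\ge 2$ and $p_2y+Q_2(p_1x+Q_1(y))\in R[x,y]$. Such a quadruplet is reduced if $Q_1(0)=Q_2(0)=0$, $p_1\in \mathcal{U}(R)$, $Q_1(y)\in R[y]$ and $\gcd(p_1,Q_1(y))=1$ (the gcd in $R$ of $p_1$ and all coefficients of $Q_1$ is $1$); $L_2^{\mathrm{red}}(R)$ is the set of reduced quadruplets. $\mathcal{B}^1(R)=\{px+Q(y) : p\in R^{\times},\ Q\in R[y]\}$. The tame automorphism group $\mathrm{TA}_2(R)$ is the subgroup of $\mathrm{GA}_2(R)$ generated by the affine automorphisms ($\sigma(x)$ and $\sigma(y)$ both of degree $1$) and the triangular automorphisms ($\sigma(x)\in R^*x+R[y]$ and $\sigma(y)\in R^*y+R$). Definitions for $F$: $F$ is tame if there exists $\sigma\in \mathrm{TA}_2(R)$ with $\sigma(y)=F$. $F$ has a mate of length $1$ if there exists $G\in \mathcal{B}^1(R)$ such that $(F,G)\in \mathrm{GA}_2(R)$. $F$ has length "$1+1$" if there exist $\sigma,\tau\in \mathrm{GA}_2(R)$ such that $\sigma(y),\tau(y)\in \mathcal{B}^1(R)$ and $\sigma\tau(y)=F$.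 *)

theory Defs
  imports
    "HOL-Algebra.QuotRing"
    "HOL-Algebra.UnivPoly"
    "HOL-Algebra.Generated_Groups"
    "HOL-Algebra.Algebraic_Closure_Type"
    "HOL-Computational_Algebra.Polynomial"
    "HOL-Computational_Algebra.Polynomial_Factorial"
begin

text \<open>
  The ring \<open>R\<close> is a type \<open>'a\<close>, \<open>qt(R)\<close> is \<open>'a fract\<close>, and \<open>R[x,y]\<close> is \<open>'a poly poly\<close>, read as
  \<open>R[y][x]\<close>: the outer indeterminate is \<open>x\<close>, the inner one is \<open>y\<close>.  Univariate polynomials over
  \<open>R/pR\<close> live in \<open>HOL-Algebra\<close>, since a quotient depending on \<open>p\<close> (possibly the zero
  ring) is not a type.
\<close>

subsection \<open>Polynomials in two variables\<close>

definition varX :: "'a::comm_ring_1 poly poly" where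
  "varX = [:0, 1:]"

definition varY :: "'a::comm_ring_1 poly poly" where
  "varY = [:[:0, 1:]:]"

definition cst :: "'a::comm_ring_1 \<Rightarrow> 'a poly poly" where
  "cst c = [:[:c:]:]"

text \<open>\<open>subst Q f\<close> is \<open>Q(f)\<close> for a univariate \<open>Q\<close>; in particular \<open>subst Q varY\<close> is \<open>Q(y)\<close>.\<close>
definition subst :: "'a::comm_ring_1 poly \<Rightarrow> 'a poly poly \<Rightarrow> 'a poly poly" where
  "subst Q f = poly (map_poly cst Q) f"

text \<open>\<open>endo f1 f2\<close> is the endomorphism \<open>(f1,f2)\<close>, which maps \<open>h\<close> to \<open>h(f1,f2)\<close>.\<close>
definition endo ::
    "'a::comm_ring_1 poly poly \<Rightarrow> 'a poly poly \<Rightarrow> 'a poly poly \<Rightarrow> 'a poly poly" where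
  "endo f1 f2 h = poly (map_poly (\<lambda>q. subst q f2) h) f1"

definition total_degree :: "'a::comm_ring_1 poly poly \<Rightarrow> nat" where
  "total_degree f = Max (insert 0 {i + j |i j. coeff (coeff f i) j \<noteq> 0})"

subsection \<open>Automorphism groups\<close>

definition alg_hom2 :: "('a::comm_ring_1 poly poly \<Rightarrow> 'a poly poly) \<Rightarrow> bool" where
  "alg_hom2 \<sigma> \<longleftrightarrow>
     (\<forall>f g. \<sigma> (f + g) = \<sigma> f + \<sigma> g) \<and>
     (\<forall>f g. \<sigma> (f * g) = \<sigma> f * \<sigma> g) \<and>
     (\<forall>c. \<sigma> (cst c) = cst c)"

definition GA2 :: "('a::comm_ring_1 poly poly \<Rightarrow> 'a poly poly) monoid" where
  "GA2 = \<lparr>carrier = {\<sigma>. alg_hom2 \<sigma> \<and> bij \<sigma>}, monoid.mult = (\<circ>), one = id\<rparr>"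

definition VA2 :: "'a::comm_ring_1 poly poly set" where
  "VA2 = {F. \<exists>\<sigma>\<in>carrier GA2. \<sigma> varY = F}"

definition affine_auts :: "('a::comm_ring_1 poly poly \<Rightarrow> 'a poly poly) set" where
  "affine_auts =
     {\<sigma> \<in> carrier GA2. total_degree (\<sigma> varX) = 1 \<and> total_degree (\<sigma> varY) = 1}"

definition triangular_auts :: "('a::comm_ring_1 poly poly \<Rightarrow> 'a poly poly) set" where
  "triangular_auts =
     {\<sigma> \<in> carrier GA2.
        (\<exists>u Q. u dvd 1 \<and> \<sigma> varX = cst u * varX + subst Q varY) \<and>
        (\<exists>v c. v dvd 1 \<and> \<sigma> varY = cst v * varY + cst c)}"

definition TA2 :: "('a::comm_ring_1 poly poly \<Rightarrow> 'a poly poly) set" where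
  "TA2 = generate GA2 (affine_auts \<union> triangular_auts)"

definition GA1 :: "('s, 'm) ring_scheme \<Rightarrow> ((nat \<Rightarrow> 's) \<Rightarrow> (nat \<Rightarrow> 's)) set" where
  "GA1 S = {\<sigma> \<in> ring_iso (UP S) (UP S).
     \<forall>c\<in>carrier S. \<sigma> (up_ring.monom (UP S) c 0) = up_ring.monom (UP S) c 0}"

definition VA1 :: "('s, 'm) ring_scheme \<Rightarrow> (nat \<Rightarrow> 's) set" where
  "VA1 S = {P. \<exists>\<sigma>\<in>GA1 S. \<sigma> (up_ring.monom (UP S) \<one>\<^bsub>S\<^esub> 1) = P}"

definition quot_ring :: "'a::comm_ring_1 \<Rightarrow> 'a set ring" where
  "quot_ring p = ring_of_type_algebra Quot (PIdl\<^bsub>ring_of_type_algebra\<^esub> p)"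

text \<open>\<open>phi p\<close> is the canonical map \<open>R \<rightarrow> R/pR\<close> extended to \<open>R[y] \<rightarrow> (R/pR)[y]\<close>.\<close>
definition phi :: "'a::comm_ring_1 \<Rightarrow> 'a poly \<Rightarrow> nat \<Rightarrow> 'a set" where
  "phi p Q = (\<lambda>n. PIdl\<^bsub>ring_of_type_algebra\<^esub> p +>\<^bsub>ring_of_type_algebra\<^esub> coeff Q n)"

subsection \<open>Quadruplets\<close>

definition assoc_reps :: "'a::idom set \<Rightarrow> bool" where
  "assoc_reps U \<longleftrightarrow>
     0 \<notin> U \<and> (\<forall>r. r \<noteq> 0 \<longrightarrow> (\<exists>!u. u \<in> U \<and> (\<exists>e. e dvd 1 \<and> r = e * u)))"

definition quad_poly ::
    "'a::comm_ring_1 \<Rightarrow> 'a \<Rightarrow> 'a poly \<Rightarrow> 'a poly \<Rightarrow> 'a poly poly" where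
  "quad_poly p1 p2 Q1 Q2 = cst p2 * varY + subst Q2 (cst p1 * varX + subst Q1 varY)"

abbreviation fract_poly2 :: "'a::idom poly poly \<Rightarrow> 'a fract poly poly" where
  "fract_poly2 \<equiv> map_poly fract_poly"

definition L2 :: "('a::idom fract \<times> 'a fract \<times> 'a fract poly \<times> 'a fract poly) set" where
  "L2 = {(p1, p2, Q1, Q2).
     p1 \<noteq> 0 \<and> p2 \<noteq> 0 \<and> degree Q1 \<ge> 1 \<and> degree Q2 \<ge> 2 \<and>
     quad_poly p1 p2 Q1 Q2 \<in> range fract_poly2}"

definition L2_red :: "'a::factorial_ring_gcd set \<Rightarrow>
    ('a fract \<times> 'a fract \<times> 'a fract poly \<times> 'a fract poly) set" where
  "L2_red U = {(p1, p2, Q1, Q2) \<in> L2.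
     poly Q1 0 = 0 \<and> poly Q2 0 = 0 \<and>
     (\<exists>r q. r \<in> U \<and> p1 = to_fract r \<and> Q1 = fract_poly q \<and> gcd r (content q) = 1)}"

subsection \<open>Tameness, mates and lengths\<close>

definition B1 :: "'a::comm_ring_1 poly poly set" where
  "B1 = {cst p * varX + subst Q varY |p Q. p \<noteq> 0}"

definition tame :: "'a::comm_ring_1 poly poly \<Rightarrow> bool" where
  "tame F \<longleftrightarrow> (\<exists>\<sigma>\<in>TA2. \<sigma> varY = F)"

definition has_mate_of_length_1 :: "'a::comm_ring_1 poly poly \<Rightarrow> bool" where
  "has_mate_of_length_1 F \<longleftrightarrow> (\<exists>G\<in>B1. endo F G \<in> carrier GA2)"

definition has_length_1_plus_1 :: "'a::comm_ring_1 poly poly \<Rightarrow> bool" where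
  "has_length_1_plus_1 F \<longleftrightarrow>
     (\<exists>\<sigma>\<in>carrier GA2. \<exists>\<tau>\<in>carrier GA2. \<sigma> varY \<in> B1 \<and> \<tau> varY \<in> B1 \<and> \<sigma> (\<tau> varY) = F)"

end

theory Submission
  imports Defs
begin

text \<open>
  Put \<open>A = p\<^sub>1 x + Q\<^sub>1(y)\<close>, so that \<open>(A, F)\<close> is an automorphism over \<open>qt(R)\<close> and
  \<open>deg\<^sub>x F = deg Q\<^sub>2 \<ge> 2\<close>.  If \<open>\<rho> \<in> GA\<^sub>2(R)\<close> and \<open>F = s \<rho>(x) + S(\<rho>(y))\<close> with \<open>s \<noteq> 0\<close>, then \<open>\<rho>(y)\<close>
  and \<open>A\<close> both complete \<open>F\<close> to an automorphism over \<open>qt(R)\<close>, hence \<open>\<rho>(y) = a A + b(F)\<close>.  When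
  \<open>deg\<^sub>x \<rho>(y) < deg\<^sub>x F\<close>, \<open>b\<close> is constant, and the gcd condition makes \<open>a\<close> an element of \<open>R\<close>, indeed
  a unit.  So \<open>A\<close> is itself a variable of \<open>R[x,y]\<close> as soon as \<open>F\<close> has a mate of length \<open>1\<close>, has
  length "\<open>1+1\<close>", or is tame (where \<open>\<rho>\<close> is an initial piece of a reduced word).  The Jacobian of
  \<open>(F, A)\<close> being \<open>-p\<^sub>1 p\<^sub>2\<close> settles the mates.  Finally \<open>A\<close> is a variable iff \<open>Q\<^sub>1\<close> is invertible
  for composition modulo \<open>p\<^sub>1\<close>: given an inverse \<open>P\<close>, \<open>((y - P(A)) / p\<^sub>1, A)\<close> is an automorphism.
\<close>

section \<open>Substitution\<close>

lemma cst_simps [simp]: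
  "cst 0 = 0" "cst (a + b) = cst a + cst b" "cst (a - b) = cst a - cst b"
  "cst (- a) = - cst a" "cst (a * b) = cst a * cst b" "cst a = cst b \<longleftrightarrow> a = b"
  by (simp_all add: cst_def)

lemma cst_1 [simp]: "cst 1 = 1"
  unfolding cst_def by (metis one_pCons)

lemma cst_eq_0_iff [simp]: "cst a = 0 \<longleftrightarrow> a = 0"
  by (simp add: cst_def)

lemma cst_cancel: "a * b = 1 \<Longrightarrow> cst a * (cst b * h) = h"
  by (metis cst_simps(5) cst_1 mult.assoc mult_1)

lemma subst_0 [simp]: "subst 0 f = 0"
  by (simp add: subst_def)

lemma subst_pCons: "subst (pCons a Q) f = cst a + f * subst Q f"
  by (simp add: subst_def map_poly_pCons)

lemma subst_const [simp]: "subst [:c:] f = cst c"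
  by (simp add: subst_pCons)

lemma subst_X [simp]: "subst [:0, 1:] f = f"
  by (simp add: subst_pCons)

lemma subst_1 [simp]: "subst 1 f = 1"
  by (simp add: one_pCons del: pCons_one)

lemma subst_add [simp]: "subst (P + Q) f = subst P f + subst Q f"
proof (induction P arbitrary: Q)
  case (pCons a P)
  show ?case
    by (cases Q) (simp add: subst_pCons pCons.IH distrib_left)
qed simp

lemma subst_smult [simp]: "subst (smult c P) f = cst c * subst P f"
  by (induction P) (simp_all add: subst_pCons algebra_simps)

lemma subst_uminus [simp]: "subst (- P) f = - subst P f"
  by (induction P) (simp_all add: subst_pCons algebra_simps)

lemma subst_diff [simp]: "subst (P - Q) f = subst P f - subst Q f"
  using subst_add[of P "- Q" f] by simp

lemma subst_mult [simp]: "subst (P * Q) f = subst P f * subst Q f"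
  by (induction P) (simp_all add: subst_pCons algebra_simps)

lemma subst_pcompose: "subst (pcompose P Q) f = subst P (subst Q f)"
  by (induction P) (simp_all add: subst_pCons pcompose_pCons)

text \<open>Viewing the coefficients of \<open>Q\<close> as constants of R[y] makes substitution a
  composition of polynomials in x, so the degree formula for composites applies.\<close>

lemma subst_conv_pcompose: "subst Q f = pcompose (map_poly (\<lambda>c. [:c:]) Q) f"
  by (induction Q) (simp_all add: subst_pCons pcompose_pCons map_poly_pCons cst_def)

lemma subst_varY: "subst Q varY = [:Q:]"
  by (induction Q) (simp_all add: subst_pCons cst_def varY_def)

lemma degree_subst:
  fixes f :: "'a::idom poly poly"
  shows "degree (subst Q f) = degree Q * degree f"
  by (simp add: subst_conv_pcompose degree_pcompose degree_map_poly)

lemma diff_dvd_subst_diff: "f - g dvd subst P f - subst P g"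
proof (induction P)
  case (pCons a P)
  then obtain k where k: "subst P f - subst P g = (f - g) * k"
    by (auto simp: dvd_def)
  have "subst (pCons a P) f - subst (pCons a P) g
      = f * (subst P f - subst P g) + (f - g) * subst P g"
    by (simp add: subst_pCons algebra_simps)
  also have "\<dots> = (f - g) * (f * k + subst P g)"
    unfolding k by (simp add: algebra_simps)
  finally show ?case by simp
qed simp

section \<open>Endomorphisms given by the images of x and y\<close>

lemma endo_0 [simp]: "endo f g 0 = 0"
  by (simp add: endo_def)

lemma endo_pCons: "endo f g (pCons q h) = subst q g + f * endo f g h"
  by (simp add: endo_def map_poly_pCons)

lemma endo_const [simp]: "endo f g [:q:] = subst q g"
  by (simp add: endo_pCons)

lemma endo_cst [simp]: "endo f g (cst c) = cst c"
  by (simp add: cst_def)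

lemma endo_varX [simp]: "endo f g varX = f"
  by (simp add: varX_def endo_pCons)

lemma endo_varY [simp]: "endo f g varY = g"
  by (simp add: varY_def)

lemma endo_1 [simp]: "endo f g 1 = 1"
  using endo_cst[of f g 1] by simp

lemma endo_add [simp]: "endo f g (h + k) = endo f g h + endo f g k"
proof (induction h arbitrary: k)
  case (pCons a h)
  show ?case
    by (cases k) (simp add: endo_pCons pCons.IH distrib_left)
qed simp

lemma endo_smult: "endo f g (smult q h) = subst q g * endo f g h"
  by (induction h) (simp_all add: endo_pCons algebra_simps)

lemma endo_mult [simp]: "endo f g (h * k) = endo f g h * endo f g k"
  by (induction h) (simp_all add: endo_pCons endo_smult algebra_simps)

lemma alg_hom2_endo: "alg_hom2 (endo f g)"
  by (simp add: alg_hom2_def)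

context
  fixes \<sigma> :: "'a::comm_ring_1 poly poly \<Rightarrow> 'a poly poly"
  assumes hom: "alg_hom2 \<sigma>"
begin

lemma alg_hom2_cst: "\<sigma> (cst c) = cst c"
  and alg_hom2_add: "\<sigma> (f + g) = \<sigma> f + \<sigma> g"
  and alg_hom2_mult: "\<sigma> (f * g) = \<sigma> f * \<sigma> g"
  using hom by (simp_all add: alg_hom2_def)

lemma alg_hom2_0: "\<sigma> 0 = 0"
  using alg_hom2_cst[of 0] by simp

lemma alg_hom2_1: "\<sigma> 1 = 1"
  using alg_hom2_cst[of 1] by simp

lemma alg_hom2_uminus: "\<sigma> (- f) = - \<sigma> f"
  using alg_hom2_mult[of "cst (-1)" f] alg_hom2_cst[of "-1"] by simp

lemma alg_hom2_diff: "\<sigma> (f - g) = \<sigma> f - \<sigma> g"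
  using alg_hom2_add[of f "- g"] alg_hom2_uminus by simp

lemma alg_hom2_subst: "\<sigma> (subst Q f) = subst Q (\<sigma> f)"
  by (induction Q) (simp_all add: subst_pCons alg_hom2_0 alg_hom2_cst alg_hom2_add alg_hom2_mult)

lemmas alg_hom2_simps =
  alg_hom2_cst alg_hom2_add alg_hom2_mult alg_hom2_0 alg_hom2_1 alg_hom2_uminus alg_hom2_diff
  alg_hom2_subst

end

lemma pCons_conv_varX: "pCons q h = subst q varY + varX * h"
  by (simp add: subst_varY varX_def)

text \<open>Constants, x and y generate R[x,y] as a ring. Identities between homomorphisms, and the
  chain rule below, are thereby reduced to generators.\<close>

lemma bipoly_induct [case_names cst varX varY add mult]:
  fixes h :: "'a::comm_ring_1 poly poly"
  assumes c: "\<And>c. P (cst c)" and x: "P varX" and y: "P varY"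
    and a: "\<And>f g. P f \<Longrightarrow> P g \<Longrightarrow> P (f + g)"
    and m: "\<And>f g. P f \<Longrightarrow> P g \<Longrightarrow> P (f * g)"
  shows "P h"
proof (induction h)
  case 0
  show ?case using c[of 0] by simp
next
  case (pCons q h)
  have "P (subst q varY)"
  proof (induction q)
    case 0
    show ?case using c[of 0] by simp
  next
    case (pCons d q)
    show ?case unfolding subst_pCons by (intro a m c y pCons.IH)
  qed
  then show ?case
    unfolding pCons_conv_varX by (intro a m x pCons.IH)
qed

lemma alg_hom2_eqI:
  assumes "alg_hom2 \<sigma>" "alg_hom2 \<tau>" "\<sigma> varX = \<tau> varX" "\<sigma> varY = \<tau> varY"
  shows "\<sigma> = \<tau>"
proof
  show "\<sigma> h = \<tau> h" for h
    by (induction h rule: bipoly_induct)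
      (simp_all add: assms alg_hom2_cst alg_hom2_add alg_hom2_mult)
qed

lemma alg_hom2_comp: "alg_hom2 \<sigma> \<Longrightarrow> alg_hom2 \<tau> \<Longrightarrow> alg_hom2 (\<sigma> \<circ> \<tau>)"
  by (simp add: alg_hom2_def)

lemma alg_hom2_id: "alg_hom2 id"
  by (simp add: alg_hom2_def)

lemma alg_hom2_conv_endo: "alg_hom2 \<sigma> \<Longrightarrow> \<sigma> = endo (\<sigma> varX) (\<sigma> varY)"
  by (rule alg_hom2_eqI) (simp_all add: alg_hom2_endo)

lemma alg_hom2_endo_apply:
  "alg_hom2 \<sigma> \<Longrightarrow> \<sigma> (endo f g h) = endo (\<sigma> f) (\<sigma> g) h"
  by (induction h rule: bipoly_induct)
    (simp_all add: alg_hom2_cst alg_hom2_add alg_hom2_mult)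

lemma endo_subst [simp]: "endo f g (subst Q h) = subst Q (endo f g h)"
  by (rule alg_hom2_subst[OF alg_hom2_endo])

lemma endo_diff [simp]: "endo f g (h - k) = endo f g h - endo f g k"
  by (rule alg_hom2_diff[OF alg_hom2_endo])

lemma endo_endo: "endo f g (endo h k p) = endo (endo f g h) (endo f g k) p"
  by (rule alg_hom2_endo_apply[OF alg_hom2_endo])

lemma endo_id [simp]: "endo varX varY h = h"
  by (induction h rule: bipoly_induct) simp_all

text \<open>When y is fixed, only the outer variable is replaced, and degrees in x multiply.\<close>

lemma endo_conv_pcompose: "endo f varY h = pcompose h f"
  by (induction h) (simp_all add: endo_pCons pcompose_pCons subst_varY)

section \<open>Automorphisms\<close>

lemma carrier_GA2: "\<sigma> \<in> carrier GA2 \<longleftrightarrow> alg_hom2 \<sigma> \<and> bij \<sigma>"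
  by (simp add: GA2_def)

lemma alg_hom2_inv:
  assumes "alg_hom2 \<sigma>" "bij \<sigma>"
  shows "alg_hom2 (inv_into UNIV \<sigma>)"
proof -
  have [simp]: "\<sigma> (inv_into UNIV \<sigma> f) = f" "inv_into UNIV \<sigma> (\<sigma> f) = f" for f
    using assms(2) by (simp_all add: bij_is_surj surj_f_inv_f bij_is_inj)
  have inj: "\<sigma> f = \<sigma> g \<Longrightarrow> f = g" for f g
    using assms(2) by (meson bij_is_inj injD)
  show ?thesis
    unfolding alg_hom2_def
    by (intro conjI allI; rule inj) (simp_all add: alg_hom2_simps[OF assms(1)])
qed

lemma GA2_I:
  assumes "alg_hom2 \<sigma>" "alg_hom2 \<tau>"
    and "\<sigma> (\<tau> varX) = varX" "\<sigma> (\<tau> varY) = varY"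
    and "\<tau> (\<sigma> varX) = varX" "\<tau> (\<sigma> varY) = varY"
  shows "\<sigma> \<in> carrier GA2"
proof -
  have "\<sigma> \<circ> \<tau> = id" "\<tau> \<circ> \<sigma> = id"
    using assms by (auto intro!: alg_hom2_eqI alg_hom2_comp alg_hom2_id)
  then show ?thesis
    using assms(1) by (simp add: carrier_GA2 o_bij)
qed

lemma GA2_endoI:
  assumes "endo f g h = varX" "endo f g k = varY" "endo h k f = varX" "endo h k g = varY"
  shows "endo f g \<in> carrier GA2"
  using assms by (intro GA2_I[where \<tau> = "endo h k"]) (simp_all add: alg_hom2_endo)

lemma GA2_comp: "\<sigma> \<in> carrier GA2 \<Longrightarrow> \<tau> \<in> carrier GA2 \<Longrightarrow> \<sigma> \<circ> \<tau> \<in> carrier GA2"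
  by (auto simp: carrier_GA2 alg_hom2_comp intro: bij_comp)

lemma GA2_id: "id \<in> carrier GA2"
  by (simp add: carrier_GA2 alg_hom2_id)

lemma GA2_inv: "\<sigma> \<in> carrier GA2 \<Longrightarrow> inv_into UNIV \<sigma> \<in> carrier GA2"
  by (simp add: carrier_GA2 alg_hom2_inv bij_imp_bij_inv)

lemma GA2_hom: "\<sigma> \<in> carrier GA2 \<Longrightarrow> alg_hom2 \<sigma>"
  by (simp add: carrier_GA2)

lemma GA2_inverses [simp]:
  assumes "\<sigma> \<in> carrier GA2"
  shows "\<sigma> (inv_into UNIV \<sigma> f) = f" "inv_into UNIV \<sigma> (\<sigma> f) = f"
  using assms by (simp_all add: carrier_GA2 bij_is_surj surj_f_inv_f bij_is_inj)

lemma GA2_comp_inverses: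
  assumes "\<sigma> \<in> carrier GA2"
  shows "\<sigma> \<circ> inv_into UNIV \<sigma> = id" "inv_into UNIV \<sigma> \<circ> \<sigma> = id"
  using assms by auto

lemma GA2_simps [simp]:
  "monoid.mult GA2 = (\<circ>)" "one GA2 = id"
  by (simp_all add: GA2_def)

lemma group_GA2: "group (GA2 :: ('a::comm_ring_1 poly poly \<Rightarrow> _) monoid)"
proof (rule groupI)
  fix \<sigma> :: "'a poly poly \<Rightarrow> 'a poly poly"
  assume \<sigma>: "\<sigma> \<in> carrier GA2"
  show "\<exists>\<tau>\<in>carrier GA2. \<tau> \<otimes>\<^bsub>GA2\<^esub> \<sigma> = \<one>\<^bsub>GA2\<^esub>"
    using \<sigma> GA2_inv[OF \<sigma>] GA2_comp_inverses[OF \<sigma>] by auto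
qed (auto simp: GA2_comp GA2_id)

lemma m_inv_GA2:
  assumes "\<sigma> \<in> carrier (GA2 :: ('a::comm_ring_1 poly poly \<Rightarrow> _) monoid)"
  shows "inv\<^bsub>GA2\<^esub> \<sigma> = inv_into UNIV \<sigma>"
proof -
  interpret group "GA2 :: ('a poly poly \<Rightarrow> _) monoid" by (rule group_GA2)
  show ?thesis
    using assms by (intro inv_equality) (auto simp: GA2_comp_inverses GA2_inv)
qed

lemma GA2_cases:
  assumes "\<sigma> \<in> carrier GA2"
  obtains f g where "\<sigma> = endo f g" "\<sigma> varX = f" "\<sigma> varY = g"
  using alg_hom2_conv_endo[OF GA2_hom[OF assms]] by blast

section \<open>The Jacobian determinant\<close>

abbreviation pderivY :: "'a::idom poly poly \<Rightarrow> 'a poly poly" where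
  "pderivY \<equiv> map_poly pderiv"

definition jac :: "'a::idom poly poly \<Rightarrow> 'a poly poly \<Rightarrow> 'a poly poly" where
  "jac f g = pderiv f * pderivY g - pderivY f * pderiv g"

lemma pderivY_add: "pderivY (f + g) = pderivY f + pderivY g"
  by (rule poly_eqI) (simp add: coeff_map_poly pderiv_add)

lemma pderivY_smult: "pderivY (smult a g) = smult a (pderivY g) + smult (pderiv a) g"
  by (rule poly_eqI) (simp add: coeff_map_poly pderiv_mult mult.commute)

lemma pderivY_mult: "pderivY (f * g) = f * pderivY g + g * pderivY f"
  by (induction f)
    (simp_all add: pderivY_add pderivY_smult map_poly_pCons algebra_simps smult_add_right)

lemma pderiv_bivariate [simp]:
  "pderiv (cst c) = 0" "pderiv varX = 1" "pderiv varY = 0"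
  "pderivY (cst c) = 0" "pderivY varX = 0" "pderivY varY = 1"
  by (simp_all add: cst_def varX_def varY_def map_poly_pCons map_poly_1 pderiv_pCons flip: one_pCons)

text \<open>The chain rule, stated for an arbitrary R-derivation \<open>D\<close> so that it serves
  for both partial derivatives at once.\<close>

lemma derivation_endo:
  fixes D :: "'a::idom poly poly \<Rightarrow> 'a poly poly"
  assumes "\<And>c. D (cst c) = 0" "\<And>f g. D (f + g) = D f + D g"
    "\<And>f g. D (f * g) = f * D g + g * D f"
  shows "D (endo f g h) = endo f g (pderiv h) * D f + endo f g (pderivY h) * D g"
  by (induction h rule: bipoly_induct)
    (simp_all add: assms pderiv_add pderiv_mult pderivY_add pderivY_mult algebra_simps)

lemma derivation_subst:
  fixes D :: "'a::idom poly poly \<Rightarrow> 'a poly poly"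
  assumes "\<And>c. D (cst c) = 0" "\<And>f g. D (f + g) = D f + D g"
    "\<And>f g. D (f * g) = f * D g + g * D f"
  shows "D (subst Q f) = subst (pderiv Q) f * D f"
  by (induction Q)
    (simp_all add: assms(1)[of 0, simplified] assms subst_pCons pderiv_pCons algebra_simps)

lemma pderiv_subst:
  "pderiv (subst Q f) = subst (pderiv Q) f * pderiv f"
  "pderivY (subst Q f) = subst (pderiv Q) f * pderivY f"
  by (intro derivation_subst; simp add: pderiv_add pderiv_mult pderivY_add pderivY_mult)+

text \<open>The chain rule applied to the components \<open>h\<close>, \<open>k\<close> of the
  inverse gives a product of two 2x2 matrices equal to the identity; determinants multiply.\<close>

lemma jac_GA2_unit:
  fixes \<rho> :: "'a::idom poly poly \<Rightarrow> 'a poly poly"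
  assumes \<rho>: "\<rho> \<in> carrier GA2"
  shows "jac (\<rho> varX) (\<rho> varY) dvd 1"
proof -
  define f g where "f = \<rho> varX" and "g = \<rho> varY"
  define h k where "h = inv_into UNIV \<rho> varX" and "k = inv_into UNIV \<rho> varY"
  have \<rho>_eq: "\<rho> = endo f g"
    unfolding f_def g_def by (rule alg_hom2_conv_endo[OF GA2_hom[OF \<rho>]])
  have hk: "endo f g h = varX" "endo f g k = varY"
    using \<rho> by (simp_all add: h_def k_def \<rho>_eq[symmetric])
  have chain: "pderiv (endo f g p) = endo f g (pderiv p) * pderiv f + endo f g (pderivY p) * pderiv g"
    "pderivY (endo f g p) = endo f g (pderiv p) * pderivY f + endo f g (pderivY p) * pderivY g" for p
    by (intro derivation_endo; simp add: pderiv_add pderiv_mult pderivY_add pderivY_mult)+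
  have "1 = endo f g (pderiv h) * pderiv f + endo f g (pderivY h) * pderiv g"
    "0 = endo f g (pderiv h) * pderivY f + endo f g (pderivY h) * pderivY g"
    "0 = endo f g (pderiv k) * pderiv f + endo f g (pderivY k) * pderiv g"
    "1 = endo f g (pderiv k) * pderivY f + endo f g (pderivY k) * pderivY g"
    using chain[of h] chain[of k] by (simp_all add: hk)
  moreover have "(a * b' - b * a') * (fx * gy - fy * gx) = 1"
    if "1 = a * fx + b * gx" "0 = a * fy + b * gy" "0 = a' * fx + b' * gx" "1 = a' * fy + b' * gy"
    for a b a' b' fx fy gx gy :: "'a poly poly"
  proof -
    have "(a * b' - b * a') * (fx * gy - fy * gx)
        = (a * fx + b * gx) * (a' * fy + b' * gy) - (a * fy + b * gy) * (a' * fx + b' * gx)"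
      by (simp add: algebra_simps)
    then show ?thesis using that by simp
  qed
  ultimately show ?thesis
    unfolding jac_def f_def[symmetric] g_def[symmetric] by (metis dvd_triv_right)
qed

lemma bipoly_unitE:
  fixes f :: "'a::idom poly poly"
  assumes "f dvd 1"
  obtains c where "f = cst c" "c dvd 1"
  using assms unfolding is_unit_poly_iff cst_def by metis

section \<open>Passing to the field of fractions\<close>

lemma fract_poly2_simps [simp]:
  fixes f g :: "'a::idom poly poly"
  shows "fract_poly2 0 = (0 :: 'a fract poly poly)"
    "fract_poly2 (f + g) = fract_poly2 f + fract_poly2 g"
    "fract_poly2 (f - g) = fract_poly2 f - fract_poly2 g"
    "fract_poly2 (smult q f) = smult (fract_poly q) (fract_poly2 f)"
    "fract_poly2 (cst c) = cst (to_fract c)"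
    "fract_poly2 varX = (varX :: 'a fract poly poly)"
    "fract_poly2 varY = (varY :: 'a fract poly poly)"
  by (auto intro!: poly_eqI simp: coeff_map_poly cst_def varX_def varY_def map_poly_pCons)

lemma fract_poly2_pCons: "fract_poly2 (pCons q f) = pCons (fract_poly q) (fract_poly2 f)"
  by (simp add: map_poly_pCons)

lemma fract_poly2_mult [simp]: "fract_poly2 (f * g) = fract_poly2 f * fract_poly2 g"
  by (induction f) (simp_all add: fract_poly2_pCons)

lemma fract_poly2_eq_iff [simp]: "fract_poly2 f = fract_poly2 g \<longleftrightarrow> f = g"
  by (auto simp: poly_eq_iff coeff_map_poly)

lemma fract_poly2_subst [simp]: "fract_poly2 (subst Q f) = subst (fract_poly Q) (fract_poly2 f)"
  by (induction Q) (simp_all add: subst_pCons map_poly_pCons)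

lemma fract_poly2_endo [simp]:
  "fract_poly2 (endo f g h) = endo (fract_poly2 f) (fract_poly2 g) (fract_poly2 h)"
  by (induction h) (simp_all add: endo_pCons fract_poly2_pCons)

lemma degree_fract_poly2 [simp]: "degree (fract_poly2 f) = degree f"
  by (rule degree_map_poly) auto

lemma fract_poly_pderiv: "pderiv (fract_poly q) = fract_poly (pderiv q)"
  by (induction q) (simp_all add: pderiv_pCons map_poly_pCons)

lemma fract_poly2_jac: "fract_poly2 (jac f g) = jac (fract_poly2 f) (fract_poly2 g)"
proof -
  have "pderiv (fract_poly2 f) = fract_poly2 (pderiv f)" for f :: "'a poly poly"
    by (induction f) (simp_all add: pderiv_pCons map_poly_pCons)
  moreover have "pderivY (fract_poly2 f) = fract_poly2 (pderivY f)" for f :: "'a poly poly"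
    by (rule poly_eqI) (simp add: coeff_map_poly fract_poly_pderiv)
  ultimately show ?thesis by (simp add: jac_def)
qed

lemma degree_le_1_conv: "degree p \<le> 1 \<Longrightarrow> p = [:coeff p 0, coeff p 1:]"
  by (rule poly_eqI) (auto simp: coeff_pCons coeff_eq_0 split: nat.split)

section \<open>Automorphisms sharing a component\<close>

text \<open>An automorphism \<open>\<Psi>\<close> over the field moves \<open>(A, F)\<close> to \<open>(x, y)\<close>; then \<open>g\<close> becomes a
  polynomial \<open>g'\<close> with \<open>x \<in> k[y][g']\<close>, which forces \<open>g'\<close> to have degree \<open>1\<close> in \<open>x\<close>.\<close>
lemma complement_of_quad_poly:
  fixes p1 p2 s :: "'k::field" and Q1 Q2 S :: "'k poly" and f g B :: "'k poly poly"
  defines "A \<equiv> cst p1 * varX + subst Q1 varY"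
  defines "F \<equiv> quad_poly p1 p2 Q1 Q2"
  assumes nz: "p1 \<noteq> 0" "p2 \<noteq> 0" "s \<noteq> 0"
    and F: "F = cst s * f + subst S g" and A: "A = endo f g B"
  shows "\<exists>a b. a \<noteq> 0 \<and> g = cst a * A + subst b F"
proof -
  have cancel: "cst (inverse c) * (cst c * h) = h" "cst c * (cst (inverse c) * h) = h"
    if "c \<noteq> 0" for c :: 'k and h
    using that by (simp_all add: cst_cancel)
  have F_eq: "F = cst p2 * varY + subst Q2 A"
    by (simp add: F_def A_def quad_poly_def)
  \<comment> \<open>\<open>(u, v)\<close> inverts \<open>(A, F)\<close>: writing x for
    \<open>A\<close> and y for \<open>F\<close>, the equation for \<open>F\<close> is solved for the
    old y, then the equation for \<open>A\<close> for the old x.\<close>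
  define v where "v = cst (inverse p2) * (varY - subst Q2 varX)"
  define u where "u = cst (inverse p1) * (varX - subst Q1 v)"
  have \<Psi>A: "endo u v A = varX"
    by (simp add: A_def u_def cancel nz)
  have \<Psi>F: "endo u v F = varY"
    by (simp add: F_eq \<Psi>A) (simp add: v_def cancel nz)
  have \<Phi>v: "endo A F v = varY"
    by (simp add: v_def) (simp add: F_eq cancel nz)
  have \<Phi>u: "endo A F u = varX"
    by (simp add: u_def \<Phi>v) (simp add: A_def cancel nz)
  have \<Phi>\<Psi>: "endo A F (endo u v h) = h" for h
    by (simp add: endo_endo \<Phi>u \<Phi>v)
  define f' g' where "f' = endo u v f" and "g' = endo u v g"
  have "varY = cst s * f' + subst S g'"
    using arg_cong[OF F, of "endo u v"] by (simp add: \<Psi>F f'_def g'_def)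
  then have "varY - subst S g' = cst s * f'"
    by (metis add_diff_cancel_right')
  then have f': "f' = cst (inverse s) * (varY - subst S g')"
    using cancel(1)[OF nz(3)] by simp
  \<comment> \<open>Since \<open>f'\<close> is a polynomial in y and \<open>g'\<close>, so is
    \<open>B(f', g')\<close>; \<open>w\<close> is that polynomial, with its outer variable standing
    for \<open>g'\<close>.\<close>
  define w where "w = endo (cst (inverse s) * (varY - subst S varX)) varX B"
  have "varX = endo f' g' B"
    using arg_cong[OF A, of "endo u v"] by (simp add: \<Psi>A endo_endo f'_def g'_def)
  also have "\<dots> = endo g' varY w"
    unfolding w_def endo_endo by (simp add: f')
  finally have w: "pcompose w g' = [:0, 1:]"
    by (simp add: endo_conv_pcompose varX_def)
  have "degree w * degree g' = 1"
    using arg_cong[OF w, of degree] by (simp add: degree_pcompose)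
  then have deg: "degree g' = 1"
    by simp
  have "lead_coeff w * lead_coeff g' ^ degree w = 1"
    using arg_cong[OF w, of lead_coeff] deg by (simp add: lead_coeff_comp)
  moreover have "degree w = 1"
    using \<open>degree w * degree g' = 1\<close> by simp
  \<comment> \<open>The leading coefficients in x have product 1, so that of \<open>g'\<close> is a
    unit of k[y], hence a nonzero constant.\<close>
  ultimately have "coeff g' 1 dvd 1"
    using deg by (metis dvd_triv_right power_one_right)
  then obtain a where a: "coeff g' 1 = [:a:]" "a \<noteq> 0"
    by (metis is_unit_poly_iff dvd_0_left zero_neq_one)
  have "g' = [:coeff g' 0, [:a:]:]"
    using degree_le_1_conv[of g'] deg a(1) by simp
  then have "g' = cst a * varX + subst (coeff g' 0) varY"
    by (simp add: cst_def varX_def subst_varY)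
  then have "endo A F g' = endo A F (cst a * varX + subst (coeff g' 0) varY)"
    by simp
  also have "\<dots> = cst a * A + subst (coeff g' 0) F"
    by (simp only: endo_add endo_mult endo_cst endo_varX endo_subst endo_varY)
  finally have "g = cst a * A + subst (coeff g' 0) F"
    by (simp only: g'_def \<Phi>\<Psi>)
  then show ?thesis
    using a(2) by blast
qed

section \<open>Reduced quadruplets\<close>

text \<open>Reducedness puts \<open>p1\<close> and \<open>Q1\<close> over R, so \<open>A\<close> is
  a polynomial over R; \<open>p2\<close> and \<open>Q2\<close> may have denominators although
  \<open>F\<close> has none.\<close>

locale reduced_quadruplet =
  fixes p1 :: "'a::factorial_ring_gcd" and p2 :: "'a fract" and Q1 :: "'a poly"
    and Q2 :: "'a fract poly" and F :: "'a poly poly"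
  assumes p1_nz: "p1 \<noteq> 0" and p2_nz: "p2 \<noteq> 0" and Q1_0: "poly Q1 0 = 0"
    and degree_Q2: "degree Q2 \<ge> 2" and coprime_Q1: "gcd p1 (content Q1) = 1"
    and fract_F: "fract_poly2 F = quad_poly (to_fract p1) p2 (fract_poly Q1) Q2"
begin

definition A :: "'a poly poly" where
  "A = cst p1 * varX + subst Q1 varY"

lemma fract_A: "fract_poly2 A = cst (to_fract p1) * varX + subst (fract_poly Q1) varY"
  by (simp add: A_def)

lemma fract_F_A: "fract_poly2 F = cst p2 * varY + subst Q2 (fract_poly2 A)"
  by (simp add: fract_F fract_A quad_poly_def)

lemma degree_A: "degree A = 1"
  using p1_nz by (simp add: A_def cst_def varX_def subst_varY)

lemma degree_F: "degree F = degree Q2"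
proof -
  have "degree (subst Q2 (fract_poly2 A)) = degree Q2"
    by (simp add: degree_subst degree_A)
  moreover have "degree (cst p2 * varY) = 0"
    by (simp add: cst_def varY_def)
  ultimately have "degree (fract_poly2 F) = degree Q2"
    unfolding fract_F_A using degree_Q2 by (subst degree_add_eq_right) auto
  then show ?thesis by simp
qed

text \<open>As \<open>\<rho>\<close> is onto, \<open>A\<close> is a polynomial in the components of
  \<open>\<rho>\<close>; this supplies the \<open>B\<close> required over the field of
  fractions.\<close>

lemma complement:
  assumes \<rho>: "\<rho> \<in> carrier GA2" and F: "F = cst s * \<rho> varX + subst S (\<rho> varY)" and s: "s \<noteq> 0"
  shows "\<exists>a b. a \<noteq> 0 \<and> fract_poly2 (\<rho> varY) = cst a * fract_poly2 A + subst b (fract_poly2 F)"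
proof -
  have "A = \<rho> (inv_into UNIV \<rho> A)"
    using \<rho> by simp
  also have "\<dots> = endo (\<rho> varX) (\<rho> varY) (inv_into UNIV \<rho> A)"
    using alg_hom2_conv_endo[OF GA2_hom[OF \<rho>]] by metis
  finally have "fract_poly2 A = endo (fract_poly2 (\<rho> varX)) (fract_poly2 (\<rho> varY))
      (fract_poly2 (inv_into UNIV \<rho> A))"
    by (metis fract_poly2_endo)
  moreover have "fract_poly2 F = cst (to_fract s) * fract_poly2 (\<rho> varX)
      + subst (fract_poly S) (fract_poly2 (\<rho> varY))"
    by (subst F) simp
  ultimately show ?thesis
    using complement_of_quad_poly[of "to_fract p1" p2 "to_fract s" "fract_poly Q1" Q2] p1_nz p2_nz s
    by (simp add: fract_A fract_F)
qed

text \<open>Because \<open>Q1\<close> has no constant term, \<open>h\<close> is a coefficient of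
  \<open>g\<close>. In lowest terms, the denominator of \<open>a\<close> divides \<open>p1\<close>
  and every coefficient of \<open>Q1\<close>, so the gcd condition makes it a unit.\<close>

lemma fract_multiple_of_A:
  assumes "fract_poly2 g = cst a * fract_poly2 A + cst h"
  shows "\<exists>c h'. g = cst c * A + cst h' \<and> a = to_fract c"
proof -
  have g: "fract_poly2 g = [: smult a (fract_poly Q1) + [:h:], [:a * to_fract p1:] :]"
    unfolding assms fract_A by (simp add: cst_def varX_def subst_varY)
  have 0: "fract_poly (coeff g 0) = smult a (fract_poly Q1) + [:h:]"
    using arg_cong[OF g, of "\<lambda>p. coeff p 0"] by (simp add: coeff_map_poly)
  have 1: "to_fract (coeff (coeff g 1) 0) = a * to_fract p1"
    using arg_cong[OF g, of "\<lambda>p. coeff (coeff p 1) 0"] by (simp add: coeff_map_poly)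
  define h' where "h' = coeff (coeff g 0) 0"
  have "coeff Q1 0 = 0"
    using Q1_0 by (simp add: poly_0_coeff_0)
  then have h: "h = to_fract h'"
    using arg_cong[OF 0, of "\<lambda>p. coeff p 0"] by (simp add: coeff_map_poly h'_def)
  define Q where "Q = coeff g 0 - [:h':]"
  have Q: "smult a (fract_poly Q1) = fract_poly Q"
    using 0 by (simp add: Q_def h map_poly_pCons)
  obtain N D where ND: "a = Fract N D" "D \<noteq> 0"
    by (cases a) auto
  then obtain n d where nd: "N = n * gcd N D" "D = d * gcd N D" "coprime n d"
    using gcd_coprime_exists[of N D] by auto
  have "d \<noteq> 0"
    using nd(2) ND(2) by auto
  have a: "a = to_fract n / to_fract d"
  proof -
    have "N * d = n * D"
      using nd by (metis mult.assoc mult.commute)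
    then show ?thesis
      using ND \<open>d \<noteq> 0\<close> by (simp add: to_fract_def eq_fract)
  qed
  have "to_fract d * to_fract (coeff (coeff g 1) 0) = to_fract n * to_fract p1"
    unfolding 1 a using \<open>d \<noteq> 0\<close> by simp
  then have "to_fract (n * p1) = to_fract (d * coeff (coeff g 1) 0)"
    by simp
  then have "d dvd n * p1"
    by (metis dvd_triv_left to_fract_eq_iff)
  then have "d dvd p1"
    using nd(3) by (metis coprime_commute coprime_dvd_mult_right_iff)
  have "fract_poly (smult n Q1) = fract_poly (smult d Q)"
    using \<open>d \<noteq> 0\<close> unfolding fract_poly_smult Q[symmetric] by (simp add: a)
  then have "smult n Q1 = smult d Q"
    by (simp only: fract_poly_eq_iff)
  then have "d dvd coeff (smult n Q1) i" for i
    by simp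
  then have "d dvd coeff Q1 i" for i
    using nd(3) by (metis coprime_commute coprime_dvd_mult_right_iff coeff_smult)
  then have "d dvd content Q1"
    by (simp add: const_poly_dvd_iff flip: const_poly_dvd_iff_dvd_content)
  with \<open>d dvd p1\<close> have "d dvd 1"
    using coprime_Q1 by (metis gcd_greatest)
  then obtain e where "1 = d * e" ..
  then have "to_fract d * to_fract e = 1"
    by (metis to_fract_1 to_fract_mult)
  then have ac: "a = to_fract (n * e)"
    using \<open>d \<noteq> 0\<close> unfolding a by (simp add: divide_eq_eq) (metis mult.assoc mult.commute mult_1)
  then have "fract_poly2 g = fract_poly2 (cst (n * e) * A + cst h')"
    unfolding assms h by simp
  then show ?thesis
    using ac unfolding fract_poly2_eq_iff by blast
qed

text \<open>Applying the inverse of \<open>\<rho>\<close> writes y as \<open>c\<close> times a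
  polynomial plus a constant; the coefficient of the monomial y then shows that \<open>c\<close>
  divides 1.\<close>

lemma unit_multiple_of_A:
  assumes \<rho>: "\<rho> \<in> carrier GA2" and g: "\<rho> varY = cst c * A + cst h"
  shows "c dvd 1"
proof -
  have "varY = inv_into UNIV \<rho> (\<rho> varY)"
    using \<rho> by simp
  also have "\<dots> = cst c * inv_into UNIV \<rho> A + cst h"
    unfolding g using alg_hom2_simps[OF GA2_hom[OF GA2_inv[OF \<rho>]]] by simp
  finally have "coeff (coeff varY 0) 1 = coeff (coeff (cst c * inv_into UNIV \<rho> A + cst h) 0) 1"
    by simp
  then have "1 = c * coeff (coeff (inv_into UNIV \<rho> A) 0) 1"
    by (simp add: varY_def cst_def)
  then show ?thesis ..
qed

text \<open>In g = a A + b(F), a nonconstant \<open>b\<close> would give b(F) degree at least deg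
  \<open>Q2\<close> in x, which \<open>A\<close>, of degree 1, cannot cancel. So \<open>b\<close> is
  constant and the two preceding lemmas apply.\<close>

lemma second_component_eq_A:
  assumes \<rho>: "\<rho> \<in> carrier GA2" and F: "F = cst s * \<rho> varX + subst S (\<rho> varY)" and s: "s \<noteq> 0"
    and deg: "degree (\<rho> varY) < degree Q2"
  shows "\<exists>c h. c dvd 1 \<and> \<rho> varY = cst c * A + cst h"
proof -
  obtain a b where a: "a \<noteq> 0"
    and g: "fract_poly2 (\<rho> varY) = cst a * fract_poly2 A + subst b (fract_poly2 F)"
    using complement[OF \<rho> F s] by blast
  have "degree b = 0"
  proof (rule ccontr)
    assume b: "degree b \<noteq> 0"
    have "degree (cst a * fract_poly2 A) \<le> 1"
      using degree_mult_le[of "cst a" "fract_poly2 A"] by (simp add: degree_A cst_def)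
    moreover have "degree (subst b (fract_poly2 F)) = degree b * degree Q2"
      by (simp add: degree_subst degree_F)
    moreover have le: "degree Q2 \<le> degree b * degree Q2"
      using b by simp
    moreover have "1 < degree b * degree Q2"
      using le degree_Q2 by linarith
    ultimately have "degree (fract_poly2 (\<rho> varY)) = degree b * degree Q2"
      unfolding g by (subst degree_add_eq_right) linarith+
    then show False
      using deg le by simp
  qed
  then obtain h where "b = [:h:]"
    by (metis degree_eq_zeroE)
  then have "fract_poly2 (\<rho> varY) = cst a * fract_poly2 A + cst h"
    using g by simp
  then obtain c h' where "\<rho> varY = cst c * A + cst h'"
    using fract_multiple_of_A by blast
  then show ?thesis
    using unit_multiple_of_A[OF \<rho>] by blast
qed

end

section \<open>Univariate polynomials over \<open>R/pR\<close>\<close>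

lemma const_dvd_imp_dvd_poly: "[:p:] dvd f \<Longrightarrow> p dvd poly f c"
  by (auto elim!: dvdE)

lemma const_dvd_pcompose:
  "[:p:] dvd f \<Longrightarrow> [:p:] dvd pcompose f g"
  by (auto simp: dvd_def pcompose_smult)

text \<open>A polynomial whose value at some point is a unit modulo \<open>p\<close> is not a zero
  divisor modulo \<open>p\<close>. The ring R/pR need not be a domain, so this replaces cancellation
  of nonzero factors.\<close>

lemma const_dvd_mult_cancel:
  fixes u v :: "'a::idom poly"
  assumes uv: "[:p:] dvd u * v" and unit: "p dvd e * poly v c - 1"
  shows "[:p:] dvd u"
proof -
  \<comment> \<open>Translating by \<open>c\<close> turns the value \<open>v(c)\<close> into a
    constant term; the coefficients of \<open>u'\<close> then vanish modulo \<open>p\<close> one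
    after another, from the lowest upwards.\<close>
  define u' v' where "u' = pcompose u [:c, 1:]" and "v' = pcompose v [:c, 1:]"
  have v'0: "coeff v' 0 = poly v c"
    by (simp add: v'_def flip: poly_0_coeff_0) (simp add: poly_pcompose)
  have "[:p:] dvd u' * v'"
    using const_dvd_pcompose[OF uv] by (simp add: u'_def v'_def pcompose_mult)
  then have uv': "p dvd coeff (u' * v') n" for n
    by (simp add: const_poly_dvd_iff)
  have "p dvd coeff u' n" for n
  proof (induction n rule: less_induct)
    case (less n)
    have "coeff (u' * v') n = (\<Sum>i<n. coeff u' i * coeff v' (n - i)) + coeff u' n * coeff v' 0"
      by (simp add: coeff_mult lessThan_Suc_atMost[symmetric])
    moreover have "p dvd (\<Sum>i<n. coeff u' i * coeff v' (n - i))"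
      using less by (intro dvd_sum) auto
    ultimately have "p dvd coeff u' n * coeff v' 0"
      using uv'[of n] by (metis dvd_add_right_iff)
    \<comment> \<open>Here \<open>e\<close> is an inverse of \<open>v(c)\<close> modulo
      \<open>p\<close>, and the difference reduces to the coefficient of \<open>u'\<close>
      itself.\<close>
    then have "p dvd e * (coeff u' n * coeff v' 0) - coeff u' n * (e * poly v c - 1)"
      using unit by (intro dvd_diff) auto
    then show ?case
      by (simp add: v'0 algebra_simps)
  qed
  then have "[:p:] dvd u'"
    by (simp add: const_poly_dvd_iff)
  then have "[:p:] dvd pcompose u' [:- c, 1:]"
    by (rule const_dvd_pcompose)
  then show ?thesis
    by (simp add: u'_def pcompose_assoc[symmetric] pcompose_pCons)
qed

text \<open>A difference quotient: f(g) - f is a multiple of g - y, and at a fixed point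
  \<open>c\<close> of \<open>g\<close> modulo \<open>p\<close> the quotient specializes to the
  derivative. Passing from f to a + y f replaces \<open>v\<close> by g v + f, which matches the
  product rule.\<close>

lemma pcompose_diff_factor:
  fixes f g :: "'a::idom poly"
  assumes "p dvd poly g c - c"
  shows "\<exists>v. pcompose f g - f = (g - [:0, 1:]) * v \<and> p dvd poly v c - poly (pderiv f) c"
proof (induction f)
  case 0
  show ?case by (intro exI[of _ 0]) simp
next
  case (pCons a f)
  then obtain v where v: "pcompose f g - f = (g - [:0, 1:]) * v" "p dvd poly v c - poly (pderiv f) c"
    by blast
  have "pcompose (pCons a f) g - pCons a f = g * (pcompose f g - f) + (g - [:0, 1:]) * f"
    by (simp add: pcompose_pCons algebra_simps)
  also have "\<dots> = (g - [:0, 1:]) * (g * v + f)"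
    unfolding v(1) by (simp only: algebra_simps)
  finally have "pcompose (pCons a f) g - pCons a f = (g - [:0, 1:]) * (g * v + f)" .
  moreover have "poly (g * v + f) c - poly (pderiv (pCons a f)) c
      = (poly g c - c) * poly v c + c * (poly v c - poly (pderiv f) c)"
    by (simp add: pderiv_pCons algebra_simps)
  then have "p dvd poly (g * v + f) c - poly (pderiv (pCons a f)) c"
    using assms v(2) by simp
  ultimately show ?case by blast
qed

text \<open>With \<open>g = P \<circ> f\<close> one has \<open>f \<circ> g = f\<close>, so \<open>(g - y) v = 0\<close> for some \<open>v\<close> with
  \<open>v(P(0)) = f'(P(0))\<close>, a unit because \<open>(f \<circ> P)' = 1\<close>.\<close>
lemma pcompose_right_inverse_mod:
  fixes f P :: "'a::idom poly"
  assumes fP: "[:p:] dvd pcompose f P - [:0, 1:]"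
  shows "[:p:] dvd pcompose P f - [:0, 1:]"
proof -
  define g c where "g = pcompose P f" and "c = poly P 0"
  have "p dvd poly (pcompose f P - [:0, 1:]) 0"
    using fP by (metis const_dvd_imp_dvd_poly)
  then have fc: "p dvd poly f c"
    by (simp add: poly_pcompose c_def)
  \<comment> \<open>Since \<open>f(c)\<close> vanishes modulo \<open>p\<close> and
    \<open>c = P(0)\<close>, the point \<open>c\<close> is fixed by g = P(f) modulo
    \<open>p\<close>.\<close>
  have "poly f c - 0 dvd poly P (poly f c) - poly P 0"
    by (induction P) (auto simp: dvd_mult2)
  then have "p dvd poly g c - c"
    using fc by (metis g_def c_def poly_pcompose diff_zero dvd_trans)
  then obtain v where v: "pcompose f g - f = (g - [:0, 1:]) * v"
      and vc: "p dvd poly v c - poly (pderiv f) c"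
    using pcompose_diff_factor by blast
  \<comment> \<open>Composition is associative: f(P(f)) - f is f(P) - y evaluated at f.\<close>
  have "pcompose f g - f = pcompose (pcompose f P - [:0, 1:]) f"
    by (simp add: g_def pcompose_diff pcompose_assoc pcompose_pCons)
  then have "[:p:] dvd (g - [:0, 1:]) * v"
    using const_dvd_pcompose[OF fP] v by metis
  \<comment> \<open>The inverse of f'(c) modulo \<open>p\<close> is P'(0), from differentiating f(P)
    = y modulo \<open>p\<close> at 0.\<close>
  moreover have "p dvd poly (pderiv P) 0 * poly v c - 1"
  proof -
    obtain k where k: "pcompose f P = [:0, 1:] + [:p:] * k"
      using fP by (metis dvdE diff_eq_eq add.commute)
    have "poly (pderiv f) c * poly (pderiv P) 0 = poly (pderiv (pcompose f P)) 0"
      by (simp add: pderiv_pcompose poly_pcompose c_def)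
    also have "\<dots> = 1 + p * poly (pderiv k) 0"
      by (simp add: k pderiv_add pderiv_smult pderiv_pCons)
    finally have "poly (pderiv P) 0 * poly v c - 1
        = poly (pderiv P) 0 * (poly v c - poly (pderiv f) c) + p * poly (pderiv k) 0"
      by (simp add: algebra_simps)
    then show ?thesis using vc by simp
  qed
  ultimately show ?thesis
    unfolding g_def by (rule const_dvd_mult_cancel)
qed

section \<open>The quotient ring R/pR and reduction of polynomials modulo p\<close>

definition residue :: "'a::comm_ring_1 \<Rightarrow> 'a \<Rightarrow> 'a set" where
  "residue p c = PIdl\<^bsub>ring_of_type_algebra\<^esub> p +>\<^bsub>ring_of_type_algebra\<^esub> c"

lemma type_algebra_simps [simp]:
  "carrier ring_of_type_algebra = UNIV" "a \<oplus>\<^bsub>ring_of_type_algebra\<^esub> b = a + b"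
  "a \<otimes>\<^bsub>ring_of_type_algebra\<^esub> b = a * b" "\<zero>\<^bsub>ring_of_type_algebra\<^esub> = 0"
  "\<one>\<^bsub>ring_of_type_algebra\<^esub> = 1"
  by (simp_all add: ring_of_type_algebra_def)

context
  fixes p :: "'a::idom"
begin

lemma ideal_PIdl: "ideal (PIdl\<^bsub>ring_of_type_algebra\<^esub> p) ring_of_type_algebra"
  by (intro cring.cgenideal_ideal cring_from_type_algebra) simp

lemma mem_PIdl: "a \<in> PIdl\<^bsub>ring_of_type_algebra\<^esub> p \<longleftrightarrow> p dvd a"
  by (auto simp: cgenideal_def dvd_def mult.commute)

lemma cring_quot_ring: "cring (quot_ring p)"
  unfolding quot_ring_def
  by (intro ideal.quotient_is_cring ideal_PIdl cring_from_type_algebra)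

lemma UP_cring_quot_ring: "UP_cring (quot_ring p)"
  using cring_quot_ring by (simp add: UP_cring_def)

lemma ring_UP_quot_ring: "ring (UP (quot_ring p))"
  using UP_cring.UP_cring[OF UP_cring_quot_ring] by (rule cring.axioms)

lemma residue_hom: "residue p \<in> ring_hom ring_of_type_algebra (quot_ring p)"
  using ideal.rcos_ring_hom[OF ideal_PIdl] by (simp add: quot_ring_def residue_def[abs_def])

lemma residue_simps:
  "residue p a \<in> carrier (quot_ring p)"
  "residue p (a + b) = residue p a \<oplus>\<^bsub>quot_ring p\<^esub> residue p b"
  "residue p (a * b) = residue p a \<otimes>\<^bsub>quot_ring p\<^esub> residue p b"
  "residue p 1 = \<one>\<^bsub>quot_ring p\<^esub>"
  using ring_hom_memE[OF residue_hom] by simp_all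

lemma residue_0: "residue p 0 = \<zero>\<^bsub>quot_ring p\<^esub>"
  using ring_hom_zero[OF residue_hom ring_from_type_algebra cring.axioms(1)[OF cring_quot_ring]]
  by simp

lemma residue_surj: "a \<in> carrier (quot_ring p) \<Longrightarrow> \<exists>c. a = residue p c"
  by (auto simp: quot_ring_def residue_def FactRing_def A_RCOSETS_def' a_r_coset_def')

lemma residue_eq_iff: "residue p a = residue p b \<longleftrightarrow> p dvd a - b"
proof -
  have "residue p a = residue p b \<longleftrightarrow> a \<ominus>\<^bsub>ring_of_type_algebra\<^esub> b \<in> PIdl\<^bsub>ring_of_type_algebra\<^esub> p"
    unfolding residue_def
    using ring.quotient_eq_iff_same_a_r_cos[OF ring_from_type_algebra ideal_PIdl] by simp
  moreover have "\<ominus>\<^bsub>ring_of_type_algebra\<^esub> b = - b"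
    by (rule abelian_group.minus_equality)
      (simp_all add: ring.is_abelian_group ring_from_type_algebra)
  ultimately show ?thesis
    by (simp add: mem_PIdl a_minus_def)
qed

lemma phi_conv_residue: "phi p Q = (\<lambda>n. residue p (coeff Q n))"
  by (simp add: phi_def residue_def)

lemma phi_in_up: "phi p Q \<in> up (quot_ring p)"
proof -
  have "bound \<zero>\<^bsub>quot_ring p\<^esub> (degree Q) (phi p Q)"
    by (auto simp: bound_def phi_conv_residue coeff_eq_0 residue_0)
  then show ?thesis
    by (auto simp: up_def phi_conv_residue residue_simps)
qed

lemma phi_closed: "phi p Q \<in> carrier (UP (quot_ring p))"
  using phi_in_up by (simp add: UP_def)

lemma phi_surj:
  assumes "u \<in> carrier (UP (quot_ring p))"
  shows "\<exists>Q. u = phi p Q"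
proof -
  from assms have "u \<in> up (quot_ring p)"
    by (simp add: UP_def)
  then obtain n where n: "bound \<zero>\<^bsub>quot_ring p\<^esub> n u" and "\<forall>i. u i \<in> carrier (quot_ring p)"
    by (auto simp: up_def)
  then have "\<exists>c. \<forall>i. u i = residue p (c i)"
    using residue_surj by (intro choice) blast
  then obtain c where c: "\<And>i. u i = residue p (c i)"
    by blast
  have "u = phi p (Poly (map c [0..<Suc n]))"
  proof
    fix i
    show "u i = phi p (Poly (map c [0..<Suc n])) i"
      using n c by (cases "i \<le> n")
        (auto simp: phi_conv_residue coeff_Poly_eq nth_default_def residue_0 bound_def simp del: upt_Suc)
  qed
  then show ?thesis by blast
qed

lemma phi_eq_iff: "phi p P = phi p Q \<longleftrightarrow> [:p:] dvd P - Q"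
  by (simp add: phi_conv_residue fun_eq_iff residue_eq_iff const_poly_dvd_iff)

lemma phi_add: "phi p (P + Q) = phi p P \<oplus>\<^bsub>UP (quot_ring p)\<^esub> phi p Q"
  using phi_in_up[of P] phi_in_up[of Q]
  by (simp add: UP_def) (simp add: phi_conv_residue residue_simps)

lemma residue_sum:
  "finite I \<Longrightarrow> residue p (sum f I) = (\<Oplus>\<^bsub>quot_ring p\<^esub>i\<in>I. residue p (f i))"
proof (induction I rule: finite_induct)
  case empty
  interpret cring "quot_ring p" by (rule cring_quot_ring)
  show ?case by (simp add: residue_0)
next
  case (insert i I)
  interpret cring "quot_ring p" by (rule cring_quot_ring)
  show ?case
    using insert by (simp add: residue_simps Pi_def)
qed

lemma phi_mult: "phi p (P * Q) = phi p P \<otimes>\<^bsub>UP (quot_ring p)\<^esub> phi p Q"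
  using phi_in_up[of P] phi_in_up[of Q]
  by (simp add: UP_def) (simp add: phi_conv_residue residue_simps residue_sum coeff_mult)

lemma phi_const: "phi p [:c:] = up_ring.monom (UP (quot_ring p)) (residue p c) 0"
  by (rule ext) (simp add: UP_def phi_conv_residue residue_simps residue_0 coeff_pCons split: nat.split)

lemma phi_X: "phi p [:0, 1:] = up_ring.monom (UP (quot_ring p)) \<one>\<^bsub>quot_ring p\<^esub> 1"
proof -
  have "\<one>\<^bsub>quot_ring p\<^esub> \<in> carrier (quot_ring p)"
    using residue_simps(1)[of 1] by (simp add: residue_simps)
  then show ?thesis
    by (auto simp: UP_def phi_conv_residue residue_simps residue_0 fun_eq_iff coeff_pCons
        split: nat.split)
qed

lemma phi_1: "phi p 1 = \<one>\<^bsub>UP (quot_ring p)\<^esub>"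
  by (auto simp: UP_def phi_conv_residue residue_simps residue_0 fun_eq_iff)

text \<open>A homomorphism fixing constants is determined by its value at y. Composition can
  therefore be computed on lifts to R[y].\<close>

lemma hom_phi:
  assumes hom: "h \<in> ring_hom (UP (quot_ring p)) (UP (quot_ring p))"
    and const: "\<And>c. c \<in> carrier (quot_ring p) \<Longrightarrow>
      h (up_ring.monom (UP (quot_ring p)) c 0) = up_ring.monom (UP (quot_ring p)) c 0"
    and X: "h (phi p [:0, 1:]) = phi p P"
  shows "h (phi p Q) = phi p (pcompose Q P)"
proof (induction Q)
  case 0
  show ?case
    using const[OF residue_simps(1)[of 0]] by (simp flip: phi_const)
next
  case (pCons a Q)
  have "pCons a Q = [:a:] + [:0, 1:] * Q"
    by simp
  then have "h (phi p (pCons a Q)) = h (phi p [:a:] \<oplus>\<^bsub>UP (quot_ring p)\<^esub> phi p [:0, 1:] \<otimes>\<^bsub>UP (quot_ring p)\<^esub> phi p Q)"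
    by (metis phi_add phi_mult)
  also have "\<dots> = h (phi p [:a:]) \<oplus>\<^bsub>UP (quot_ring p)\<^esub> h (phi p [:0, 1:]) \<otimes>\<^bsub>UP (quot_ring p)\<^esub> h (phi p Q)"
    using ring_hom_memE(2,3)[OF hom] phi_closed by (metis phi_mult)
  also have "\<dots> = phi p (pcompose (pCons a Q) P)"
    using const[OF residue_simps(1)[of a]]
    by (simp add: pCons.IH X pcompose_pCons phi_add phi_mult phi_const)
  finally show ?case .
qed

text \<open>Turns automorphisms of (R/pR)[y] into congruences between polynomials over R, so that
  the remaining arguments stay in \<open>'a poly\<close>. The polynomial \<open>P\<close> lifts the
  image of y under the inverse automorphism.\<close>

lemma phi_mem_VA1_iff:
  "phi p Q \<in> VA1 (quot_ring p) \<longleftrightarrow>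
    (\<exists>P. [:p:] dvd pcompose Q P - [:0, 1:] \<and> [:p:] dvd pcompose P Q - [:0, 1:])"
proof
  assume "phi p Q \<in> VA1 (quot_ring p)"
  then obtain \<sigma> where iso: "\<sigma> \<in> ring_iso (UP (quot_ring p)) (UP (quot_ring p))"
    and const: "\<And>c. c \<in> carrier (quot_ring p) \<Longrightarrow>
      \<sigma> (up_ring.monom (UP (quot_ring p)) c 0) = up_ring.monom (UP (quot_ring p)) c 0"
    and X: "\<sigma> (phi p [:0, 1:]) = phi p Q"
    by (auto simp: VA1_def GA1_def phi_X)
  define \<tau> where "\<tau> = inv_into (carrier (UP (quot_ring p))) \<sigma>"
  have \<tau>_iso: "\<tau> \<in> ring_iso (UP (quot_ring p)) (UP (quot_ring p))"
    unfolding \<tau>_def by (rule ring_iso_set_sym[OF ring_UP_quot_ring iso])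
  have inj: "inj_on \<sigma> (carrier (UP (quot_ring p)))"
    using iso by (auto simp: ring_iso_def bij_betw_def)
  have \<tau>\<sigma>: "\<tau> (\<sigma> u) = u" if "u \<in> carrier (UP (quot_ring p))" for u
    unfolding \<tau>_def by (rule inv_into_f_f[OF inj that])
  have \<tau>_const: "\<tau> (up_ring.monom (UP (quot_ring p)) c 0) = up_ring.monom (UP (quot_ring p)) c 0"
    if "c \<in> carrier (quot_ring p)" for c
    using \<tau>\<sigma> const that phi_closed phi_const residue_surj by metis
  have "\<tau> (phi p [:0, 1:]) \<in> carrier (UP (quot_ring p))"
    using ring_iso_memE(1)[OF \<tau>_iso] phi_closed by blast
  then obtain P where P: "\<tau> (phi p [:0, 1:]) = phi p P"
    using phi_surj by metis
  have "phi p (pcompose Q P) = \<tau> (phi p Q)"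
    using hom_phi[OF _ \<tau>_const P] \<tau>_iso by (simp add: ring_iso_def)
  also have "\<dots> = phi p [:0, 1:]"
    using \<tau>\<sigma>[OF phi_closed] X by metis
  finally have 1: "[:p:] dvd pcompose Q P - [:0, 1:]"
    by (simp add: phi_eq_iff)
  have "\<sigma> (phi p P) = phi p [:0, 1:]"
    unfolding P[symmetric] \<tau>_def
    using ring_iso_memE(5)[OF iso] phi_closed by (rule bij_betw_inv_into_right)
  moreover have "\<sigma> (phi p P) = phi p (pcompose P Q)"
    using hom_phi[OF _ const X] iso by (simp add: ring_iso_def)
  ultimately have "[:p:] dvd pcompose P Q - [:0, 1:]"
    by (simp add: phi_eq_iff)
  with 1 show "\<exists>P. [:p:] dvd pcompose Q P - [:0, 1:] \<and> [:p:] dvd pcompose P Q - [:0, 1:]"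
    by blast
next
  assume "\<exists>P. [:p:] dvd pcompose Q P - [:0, 1:] \<and> [:p:] dvd pcompose P Q - [:0, 1:]"
  then obtain P where P: "[:p:] dvd pcompose Q P - [:0, 1:]" "[:p:] dvd pcompose P Q - [:0, 1:]"
    by blast
  \<comment> \<open>The automorphism is defined on arbitrarily chosen lifts; congruent lifts have
    congruent composites, so the choice does not matter.\<close>
  define lift where "lift u = (SOME f. u = phi p f)" for u
  have lift: "phi p (lift u) = u" if "u \<in> carrier (UP (quot_ring p))" for u
    unfolding lift_def using someI_ex[OF phi_surj[OF that]] by simp
  define \<sigma> where "\<sigma> H u = phi p (pcompose (lift u) H)" for H u
  have \<sigma>: "\<sigma> H (phi p f) = phi p (pcompose f H)" for H f
  proof -
    have "[:p:] dvd lift (phi p f) - f"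
      using lift[OF phi_closed] by (simp add: phi_eq_iff[symmetric])
    from const_dvd_pcompose[OF this, of H] show ?thesis
      by (simp add: \<sigma>_def phi_eq_iff pcompose_diff)
  qed
  have ex: "\<exists>f. u = phi p f" if "u \<in> carrier (UP (quot_ring p))" for u
    by (rule phi_surj[OF that])
  have inverses: "\<sigma> H (\<sigma> K u) = u"
    if dvd: "[:p:] dvd pcompose K H - [:0, 1:]" and u: "u \<in> carrier (UP (quot_ring p))" for H K u
  proof -
    obtain f where f: "u = phi p f" using ex[OF u] by blast
    \<comment> \<open>Substituting two arguments into \<open>f\<close> changes the result by a
      multiple of their difference; hence K(H) congruent to y gives f(K(H)) congruent to
      \<open>f\<close>.\<close>
    have "pcompose K H - [:0, 1:] dvd pcompose f (pcompose K H) - pcompose f [:0, 1:]"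
    proof (induction f)
      case (pCons a f)
      have "pcompose (pCons a f) (pcompose K H) - pcompose (pCons a f) [:0, 1:]
          = pcompose K H * (pcompose f (pcompose K H) - pcompose f [:0, 1:])
            + (pcompose K H - [:0, 1:]) * pcompose f [:0, 1:]"
        by (simp only: pcompose_pCons algebra_simps)
      then show ?case using pCons.IH by simp
    qed simp
    then show ?thesis
      using dvd by (auto simp: f \<sigma> phi_eq_iff pcompose_assoc intro: dvd_trans)
  qed
  have closed: "\<sigma> H u \<in> carrier (UP (quot_ring p))" for H u
    by (simp add: \<sigma>_def phi_closed)
  have "\<sigma> Q \<in> ring_iso (UP (quot_ring p)) (UP (quot_ring p))"
  proof (rule ring_iso_memI)
    show "\<sigma> Q \<one>\<^bsub>UP (quot_ring p)\<^esub> = \<one>\<^bsub>UP (quot_ring p)\<^esub>"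
      by (simp add: \<sigma> pcompose_1 flip: phi_1)
    show "bij_betw (\<sigma> Q) (carrier (UP (quot_ring p))) (carrier (UP (quot_ring p)))"
      using P by (intro bij_betw_byWitness[where f' = "\<sigma> P"]) (auto simp: inverses closed)
    show "\<sigma> Q (u \<otimes>\<^bsub>UP (quot_ring p)\<^esub> v) = \<sigma> Q u \<otimes>\<^bsub>UP (quot_ring p)\<^esub> \<sigma> Q v"
      "\<sigma> Q (u \<oplus>\<^bsub>UP (quot_ring p)\<^esub> v) = \<sigma> Q u \<oplus>\<^bsub>UP (quot_ring p)\<^esub> \<sigma> Q v"
      if "u \<in> carrier (UP (quot_ring p))" "v \<in> carrier (UP (quot_ring p))" for u v
      using ex[OF that(1)] ex[OF that(2)]
      by (auto simp: \<sigma> pcompose_mult pcompose_add simp flip: phi_mult phi_add)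
  qed (rule closed)
  moreover have "\<sigma> Q (up_ring.monom (UP (quot_ring p)) c 0) = up_ring.monom (UP (quot_ring p)) c 0"
    if "c \<in> carrier (quot_ring p)" for c
    using residue_surj[OF that] by (auto simp: \<sigma> simp flip: phi_const)
  ultimately have "\<sigma> Q \<in> GA1 (quot_ring p)"
    by (simp add: GA1_def)
  moreover have "\<sigma> Q (phi p [:0, 1:]) = phi p Q"
    by (simp add: \<sigma> pcompose_pCons)
  ultimately show "phi p Q \<in> VA1 (quot_ring p)"
    by (auto simp: VA1_def phi_X)
qed

end

section \<open>Mates and lengths\<close>

text \<open>A criterion in terms of degrees only. Degrees survive extension to the field of
  fractions, so membership in \<open>B1\<close> can be tested there.\<close>

lemma B1_iff:
  fixes f :: "'a::idom poly poly"
  shows "f \<in> B1 \<longleftrightarrow> degree f = 1 \<and> degree (coeff f 1) = 0"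
proof
  assume "f \<in> B1"
  then obtain p Q where "p \<noteq> 0" "f = cst p * varX + subst Q varY"
    by (auto simp: B1_def)
  then have "f = [:Q, [:p:]:]" "p \<noteq> 0"
    by (simp_all add: cst_def varX_def subst_varY)
  then show "degree f = 1 \<and> degree (coeff f 1) = 0"
    by simp
next
  assume f: "degree f = 1 \<and> degree (coeff f 1) = 0"
  then obtain p where p: "coeff f 1 = [:p:]"
    by (metis degree_eq_zeroE)
  then have "f = [:coeff f 0, [:p:]:]"
    using degree_le_1_conv[of f] f by simp
  then have "f = cst p * varX + subst (coeff f 0) varY"
    by (simp add: cst_def varX_def subst_varY)
  moreover have "p \<noteq> 0"
    using f p by (metis coeff_0 degree_0 leading_coeff_0_iff pCons_0_0 zero_neq_one)
  ultimately show "f \<in> B1"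
    by (auto simp: B1_def)
qed

lemma B1_fract_iff: "fract_poly2 f \<in> B1 \<longleftrightarrow> f \<in> B1"
proof -
  have "degree (coeff (fract_poly2 f) 1) = degree (coeff f 1)"
    by (simp add: coeff_map_poly degree_map_poly)
  then show ?thesis
    by (simp add: B1_iff)
qed

text \<open>Taking the coefficient of index 0 means setting x = 0, which commutes with
  substitution.\<close>

lemma coeff_subst_0: "coeff (subst Q f) 0 = pcompose Q (coeff f 0)"
  by (induction Q) (simp_all add: subst_pCons pcompose_pCons coeff_mult_0 cst_def)

text \<open>Adding a polynomial in \<open>f\<close> to the second component is a row operation on
  the Jacobian matrix.\<close>

lemma jac_linear_right: "jac f (cst c * g + subst b f) = cst c * jac f g"
  by (simp add: jac_def pderiv_add pderiv_mult pderivY_add pderivY_mult pderiv_subst algebra_simps)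

lemma jac_linear_left: "jac (cst c * varY + subst b f) f = - (cst c * pderiv f)"
  by (simp add: jac_def pderiv_add pderiv_mult pderivY_add pderivY_mult pderiv_subst algebra_simps)

lemma unit_cst_dvd: "c dvd 1 \<Longrightarrow> \<exists>e. c * e = 1 \<and> e * c = 1"
  for c :: "'a::comm_ring_1"
  by (metis dvdE mult.commute)

lemma swap_in_GA2: "endo varY varX \<in> carrier GA2"
  by (rule GA2_endoI[where h = varY and k = varX]) simp_all

context reduced_quadruplet
begin

section \<open>Mates and the Jacobian of (F, A)\<close>

lemma A_in_B1: "A \<in> B1"
  using p1_nz by (auto simp: B1_def A_def)

lemma jac_F_A: "jac (fract_poly2 F) (fract_poly2 A) = - cst (to_fract p1 * p2)"
proof -
  have "pderiv (fract_poly2 A) = cst (to_fract p1)"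
    unfolding fract_A by (simp add: pderiv_add pderiv_mult pderiv_subst)
  then show ?thesis
    unfolding fract_F_A jac_linear_left by (simp add: mult.commute)
qed

text \<open>A mate \<open>G\<close> has degree 1 in x, below deg \<open>Q2\<close>, so G = c A + h
  with \<open>c\<close> a unit. The Jacobian of (F, G) is then -c p1 p2, and it must be a unit of
  R.\<close>

lemma mate_imp_unit:
  assumes "has_mate_of_length_1 F"
  shows "\<exists>u. u dvd 1 \<and> to_fract p1 * p2 = to_fract u"
proof -
  obtain G where G: "G \<in> B1" "endo F G \<in> carrier GA2"
    using assms by (auto simp: has_mate_of_length_1_def)
  have "\<exists>c h. c dvd 1 \<and> endo F G varY = cst c * A + cst h"
    using G degree_Q2 by (intro second_component_eq_A[where s = 1 and S = 0]) (auto simp: B1_iff)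
  then obtain c h where c: "c dvd 1" and Geq: "G = cst c * A + cst h"
    by auto
  obtain e where e: "jac F G = cst e" "e dvd 1"
    using jac_GA2_unit[OF G(2)] bipoly_unitE by auto
  have "cst (to_fract e) = fract_poly2 (jac F G)"
    by (simp add: e)
  also have "\<dots> = cst (to_fract c) * jac (fract_poly2 F) (fract_poly2 A)"
    using jac_linear_right[of "fract_poly2 F" "to_fract c" "fract_poly2 A" "[:to_fract h:]"]
    by (simp add: fract_poly2_jac Geq)
  also have "\<dots> = cst (- to_fract c * (to_fract p1 * p2))"
    by (simp add: jac_F_A)
  finally have eq: "to_fract e = - to_fract c * (to_fract p1 * p2)"
    by (simp only: cst_simps(6))
  obtain c' where c': "c' * c = 1"
    using unit_cst_dvd[OF c] by blast
  then have "to_fract c' * to_fract c = 1"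
    by (metis to_fract_1 to_fract_mult)
  then have "to_fract p1 * p2 = to_fract (- (c' * e))"
    by (simp add: eq)
  moreover have "- (c' * e) dvd 1"
    using e(2) dvdI[OF c'[symmetric]] by (simp add: is_unit_mult_iff)
  ultimately show ?thesis by blast
qed

text \<open>The mate is \<open>A\<close> itself. Some \<open>f\<close> completes \<open>F\<close> to
  an automorphism over R, and f = a A + b(F) over the field; once \<open>a\<close> is a unit of R
  and \<open>b\<close> has coefficients in R, an elementary change replaces \<open>f\<close> by
  \<open>A\<close>.\<close>

lemma unit_imp_mate:
  assumes "u dvd 1" and u: "to_fract p1 * p2 = to_fract u" and "F \<in> VA2"
  shows "has_mate_of_length_1 F"
proof -
  obtain \<rho> where \<rho>: "\<rho> \<in> carrier GA2" "\<rho> varY = F"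
    using assms(3) by (auto simp: VA2_def)
  define f where "f = \<rho> varX"
  \<comment> \<open>Exchanging the variables makes \<open>F\<close> the first component, so
    \<open>complement\<close> describes \<open>f\<close>.\<close>
  have sw: "\<rho> \<circ> endo varY varX \<in> carrier GA2"
    using \<rho> swap_in_GA2 by (intro GA2_comp)
  have "\<exists>a b. a \<noteq> 0 \<and> fract_poly2 ((\<rho> \<circ> endo varY varX) varY)
      = cst a * fract_poly2 A + subst b (fract_poly2 F)"
    by (rule complement[OF sw, where s = 1 and S = 0]) (simp_all add: \<rho>)
  then obtain a b where f: "fract_poly2 f = cst a * fract_poly2 A + subst b (fract_poly2 F)"
    by (auto simp: f_def)
  obtain e where e: "jac F f = cst e" "e dvd 1"
    using jac_GA2_unit[OF sw] bipoly_unitE by (auto simp: \<rho> f_def)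
  have "cst (to_fract e) = fract_poly2 (jac F f)"
    by (simp add: e)
  also have "\<dots> = cst (- a * to_fract u)"
    unfolding fract_poly2_jac f jac_linear_right jac_F_A u by simp
  finally have eq: "to_fract e = - a * to_fract u"
    by (simp only: cst_simps(6))
  obtain u' where u': "u * u' = 1"
    using unit_cst_dvd[OF assms(1)] by blast
  then have "to_fract u * to_fract u' = 1"
    by (metis to_fract_1 to_fract_mult)
  then have a: "a = to_fract (- (e * u'))"
    by (simp add: eq)
  define c where "c = - (e * u')"
  have "c dvd 1"
    using e(2) dvdI[of 1 u' u] u' by (simp add: c_def is_unit_mult_iff mult.commute)
  then obtain c' where c': "c * c' = 1" "c' * c = 1"
    using unit_cst_dvd by blast
  \<comment> \<open>The inverse of \<open>\<rho>\<close> takes f - c A = b(F) to b(y), so b(y) lies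
    in R[x,y]; this clears the denominators of \<open>b\<close>.\<close>
  define E where "E = inv_into UNIV \<rho> (f - cst c * A)"
  obtain U V where inv: "inv_into UNIV \<rho> = endo U V"
    using GA2_cases[OF GA2_inv[OF \<rho>(1)]] by blast
  have "fract_poly2 (f - cst c * A) = subst b (fract_poly2 F)"
    using f a by (simp add: c_def)
  then have "fract_poly2 E = subst b (fract_poly2 (endo U V F))"
    unfolding E_def inv fract_poly2_endo by (simp only: endo_subst)
  also have "endo U V F = varY"
    using \<rho> GA2_inverses(2)[OF \<rho>(1), of varY] by (simp add: inv)
  finally have "fract_poly2 E = [:b:]"
    by (simp add: subst_varY)
  then have b: "b = fract_poly (coeff E 0)"
    by (metis coeff_map_poly coeff_pCons_0 map_poly_0)
  define b' where "b' = coeff E 0"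
  have "fract_poly2 f = fract_poly2 (cst c * A + subst b' F)"
    unfolding f b'_def c_def by (simp add: a b)
  then have "f = cst c * A + subst b' F"
    by (simp only: fract_poly2_eq_iff)
  then have "f - subst b' F = cst c * A"
    by simp
  then have A: "cst c' * (f - subst b' F) = A"
    using c' by (simp add: cst_cancel)
  \<comment> \<open>After \<open>\<rho>\<close>, this sends x to \<open>F\<close> and y to c'(f -
    b'(F)) = A.\<close>
  define \<theta> where "\<theta> = endo varY (cst c' * (varX - subst b' varY))"
  have "\<theta> \<in> carrier GA2"
    unfolding \<theta>_def
    by (rule GA2_endoI[where h = "cst c * varY + subst b' varX" and k = varX])
      (simp_all add: cst_cancel c')
  then have "\<rho> \<circ> \<theta> \<in> carrier GA2"
    using \<rho> by (intro GA2_comp)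
  moreover have "(\<rho> \<circ> \<theta>) varX = F" "(\<rho> \<circ> \<theta>) varY = A"
    by (simp_all add: \<theta>_def \<rho> alg_hom2_simps[OF GA2_hom[OF \<rho>(1)]] A flip: f_def)
  ultimately have "endo F A \<in> carrier GA2"
    by (metis alg_hom2_conv_endo GA2_hom)
  then show ?thesis
    using A_in_B1 by (auto simp: has_mate_of_length_1_def)
qed

text \<open>With the swap as second factor, (F, G) sends y to \<open>G\<close>, the swap sends y to
  x, and the composite sends y to \<open>F\<close>.\<close>

lemma mate_imp_length_1_plus_1:
  assumes "has_mate_of_length_1 F"
  shows "has_length_1_plus_1 F"
proof -
  obtain G where G: "G \<in> B1" "endo F G \<in> carrier GA2"
    using assms by (auto simp: has_mate_of_length_1_def)
  have "varX \<in> (B1 :: 'a poly poly set)"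
    by (simp add: B1_iff varX_def)
  then show ?thesis
    unfolding has_length_1_plus_1_def
    using G swap_in_GA2 by (intro bexI[of _ "endo F G"] bexI[of _ "endo varY varX"]) auto
qed

text \<open>\<open>A\<close> is the image of y up to an affine change, so a polynomial identity p1 W
  + Q1(V) = y holds up to that change. Setting x = 0 gives a right inverse of \<open>Q1\<close>
  modulo \<open>p1\<close>, which is also a left inverse.\<close>

lemma length_1_plus_1_imp_VA1:
  assumes "has_length_1_plus_1 F"
  shows "phi p1 Q1 \<in> VA1 (quot_ring p1)"
proof -
  obtain \<sigma> \<tau> where \<sigma>: "\<sigma> \<in> carrier GA2" and B1: "\<sigma> varY \<in> B1" "\<tau> varY \<in> B1" and F: "F = \<sigma> (\<tau> varY)"
    using assms by (auto simp: has_length_1_plus_1_def)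
  note hom = alg_hom2_simps[OF GA2_hom[OF \<sigma>]] alg_hom2_simps[OF GA2_hom[OF GA2_inv[OF \<sigma>]]]
  obtain s S where s: "s \<noteq> 0" "\<tau> varY = cst s * varX + subst S varY"
    using B1(2) by (auto simp: B1_def)
  have "\<exists>c h. c dvd 1 \<and> \<sigma> varY = cst c * A + cst h"
    using \<sigma> s B1(1) degree_Q2 F by (intro second_component_eq_A[where s = s and S = S])
      (auto simp: B1_iff hom)
  then obtain c h e where c: "e * c = 1" and eq: "\<sigma> varY = cst c * A + cst h"
    using unit_cst_dvd by metis
  define W V where "W = inv_into UNIV \<sigma> varX" and "V = inv_into UNIV \<sigma> varY"
  have "varY = inv_into UNIV \<sigma> (\<sigma> varY)"
    using \<sigma> by simp
  also have "\<dots> = cst c * (cst p1 * W + subst Q1 V) + cst h"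
    unfolding eq by (simp add: A_def hom W_def V_def)
  finally have "coeff varY 0 = coeff (cst c * (cst p1 * W + subst Q1 V) + cst h) 0"
    by simp
  then have *: "[:0, 1:] = smult c (smult p1 (coeff W 0) + pcompose Q1 (coeff V 0)) + [:h:]"
    by (simp add: varY_def cst_def coeff_subst_0)
  \<comment> \<open>Substituting h + c y for y undoes the affine change: \<open>h\<close> cancels
    and \<open>c\<close> can be divided out.\<close>
  define P where "P = pcompose (coeff V 0) [:h, c:]"
  have "[:h, c:] = smult c (smult p1 (pcompose (coeff W 0) [:h, c:]) + pcompose Q1 P) + [:h:]"
    using arg_cong[OF *, of "\<lambda>f. pcompose f [:h, c:]"]
    by (simp add: pcompose_add pcompose_smult P_def pcompose_assoc pcompose_pCons)
  then have "[:h, c:] - [:h:] = smult c (smult p1 (pcompose (coeff W 0) [:h, c:]) + pcompose Q1 P)"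
    by (metis add_diff_cancel_right')
  from arg_cong[OF this, of "smult e"]
  have "[:0, 1:] = smult p1 (pcompose (coeff W 0) [:h, c:]) + pcompose Q1 P"
    by (simp add: c smult_smult del: smult_add_right)
  then have "pcompose Q1 P - [:0, 1:] = [:p1:] * - pcompose (coeff W 0) [:h, c:]"
    by simp
  then have "[:p1:] dvd pcompose Q1 P - [:0, 1:]" ..
  then show ?thesis
    using pcompose_right_inverse_mod by (auto simp: phi_mem_VA1_iff)
qed

text \<open>From an inverse \<open>P\<close> of \<open>Q1\<close> modulo \<open>p1\<close>, the
  pairs (G, A) and (W, V) below are built as mutually inverse automorphisms over R. Composing
  \<open>F\<close> with (W, V) leaves an element of \<open>B1\<close>.\<close>

lemma VA1_imp_length_1_plus_1:
  assumes "phi p1 Q1 \<in> VA1 (quot_ring p1)" and "F \<in> VA2"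
  shows "has_length_1_plus_1 F"
proof -
  obtain P where P: "[:p1:] dvd pcompose Q1 P - [:0, 1:]" "[:p1:] dvd pcompose P Q1 - [:0, 1:]"
    using assms(1) by (auto simp: phi_mem_VA1_iff)
  \<comment> \<open>Modulo \<open>p1\<close> the term p1 x disappears, leaving y - K(H(y)), which is
    zero modulo \<open>p1\<close>.\<close>
  have mod_p1: "cst p1 dvd varY - subst K (cst p1 * varX + subst H varY)"
    if dvd: "[:p1:] dvd pcompose K H - [:0, 1:]" for H K
  proof -
    obtain k where "pcompose K H - [:0, 1:] = [:p1:] * k"
      using dvd by (rule dvdE)
    then have "subst K (subst H varY) - varY = cst p1 * subst k varY"
      by (metis subst_pcompose subst_diff subst_mult subst_X subst_const)
    moreover have "cst p1 * varX + subst H varY - subst H varY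
        dvd subst K (cst p1 * varX + subst H varY) - subst K (subst H varY)"
      by (rule diff_dvd_subst_diff)
    then obtain l where
      "subst K (cst p1 * varX + subst H varY) - subst K (subst H varY) = cst p1 * varX * l"
      by (auto simp: dvd_def)
    ultimately have "varY - subst K (cst p1 * varX + subst H varY) = cst p1 * (- subst k varY - varX * l)"
      by (simp add: algebra_simps)
    then show ?thesis ..
  qed
  define V where "V = cst p1 * varX + subst P varY"
  obtain G where G: "varY - subst P A = cst p1 * G"
    using mod_p1[OF P(2)] unfolding A_def ..
  obtain W where W: "varY - subst Q1 V = cst p1 * W"
    using mod_p1[OF P(1)] unfolding V_def ..
  have cancel: "f = g" if "cst p1 * f = cst p1 * g" for f g
    using that p1_nz by simp
  have GV: "endo G A V = varY"
    using G by (simp add: V_def algebra_simps)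
  have WA: "endo W V A = varY"
    using W by (simp add: A_def algebra_simps)
  \<comment> \<open>\<open>W\<close> and \<open>G\<close> are known only through their multiples by
    \<open>p1\<close>, so the identities are checked after multiplication by
    \<open>p1\<close>.\<close>
  have "cst p1 * endo G A W = endo G A (cst p1 * W)"
    by simp
  also have "\<dots> = cst p1 * varX"
    unfolding W[symmetric] by (simp add: GV) (simp add: A_def)
  finally have GW: "endo G A W = varX"
    by (rule cancel)
  have "cst p1 * endo W V G = endo W V (cst p1 * G)"
    by simp
  also have "\<dots> = cst p1 * varX"
    unfolding G[symmetric] by (simp add: WA) (simp add: V_def)
  finally have WG: "endo W V G = varX"
    by (rule cancel)
  have \<sigma>: "endo G A \<in> carrier GA2" and \<sigma>': "endo W V \<in> carrier GA2"
    using GV WA GW WG by (auto intro: GA2_endoI)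
  have \<sigma>\<sigma>': "endo G A (endo W V h) = h" for h
    by (simp add: endo_endo GW GV)
  obtain \<rho> where \<rho>: "\<rho> \<in> carrier GA2" "\<rho> varY = F"
    using assms(2) by (auto simp: VA2_def)
  \<comment> \<open>As A(W, V) = y, this is p2 V + Q2(y) = p1 p2 x + p2 P(y) + Q2(y). Its
    coefficients are in R, since \<open>endo W V F\<close> is.\<close>
  have "fract_poly2 (endo W V F) = cst p2 * fract_poly2 V + subst Q2 (fract_poly2 (endo W V A))"
    by (simp add: fract_F_A)
  also have "\<dots> = cst (to_fract p1 * p2) * varX + subst (smult p2 (fract_poly P) + Q2) varY"
    unfolding WA by (simp add: V_def algebra_simps)
  also have "\<dots> \<in> B1"
  proof -
    have "to_fract p1 * p2 \<noteq> 0"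
      using p1_nz p2_nz by simp
    then show ?thesis
      unfolding B1_def by blast
  qed
  finally have "endo W V F \<in> B1"
    by (simp only: B1_fract_iff)
  then show ?thesis
    unfolding has_length_1_plus_1_def
    using \<sigma> GA2_comp[OF \<sigma>' \<rho>(1)] A_in_B1
    by (intro bexI[of _ "endo G A"] bexI[of _ "endo W V \<circ> \<rho>"]) (auto simp: \<rho> \<sigma>\<sigma>')
qed

end

section \<open>A normal form for tame automorphisms\<close>

text \<open>Affine automorphisms described by coefficients instead of \<open>total_degree\<close>,
  so that closure under composition and inversion is plain linear algebra.\<close>

definition linear_auts :: "('a::comm_ring_1 poly poly \<Rightarrow> 'a poly poly) set" where
  "linear_auts = {\<sigma> \<in> carrier GA2.
     (\<exists>a b c. \<sigma> varX = cst a * varX + cst b * varY + cst c) \<and>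
     (\<exists>a b c. \<sigma> varY = cst a * varX + cst b * varY + cst c)}"

text \<open>\<open>Max\<close> bounds its elements only on a finite set, so the exponents are first
  enclosed in a finite box.\<close>

lemma total_degree_ge:
  assumes "coeff (coeff f i) j \<noteq> 0"
  shows "i + j \<le> total_degree f"
proof -
  define M where "M = {..degree f} \<times> {..Max ((degree \<circ> coeff f) ` {..degree f})}"
  have "{i + j |i j. coeff (coeff f i) j \<noteq> 0} \<subseteq> (\<lambda>(i, j). i + j) ` M"
  proof safe
    fix i j assume ij: "coeff (coeff f i) j \<noteq> 0"
    then have i: "i \<le> degree f"
      by (metis coeff_0 le_degree)
    have "j \<le> degree (coeff f i)"
      using ij by (rule le_degree)
    also have "\<dots> \<le> Max ((degree \<circ> coeff f) ` {..degree f})"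
      using i by (intro Max_ge) auto
    finally show "i + j \<in> (\<lambda>(i, j). i + j) ` M"
      using i by (force simp: M_def)
  qed
  then have "finite {i + j |i j. coeff (coeff f i) j \<noteq> 0}"
    by (rule finite_subset) (simp add: M_def)
  then show ?thesis
    unfolding total_degree_def using assms by (intro Max_ge) auto
qed

lemma total_degree_1_imp_linear:
  assumes "total_degree f = 1"
  shows "\<exists>a b c. f = cst a * varX + cst b * varY + cst c"
proof -
  have 0: "coeff (coeff f i) j = 0" if "i + j > 1" for i j
    using total_degree_ge[of f i j] assms that by fastforce
  have "degree f \<le> 1"
    by (rule degree_le) (auto intro!: poly_eqI simp: 0)
  moreover have "degree (coeff f 0) \<le> 1"
    by (rule degree_le) (auto simp: 0)
  moreover have "degree (coeff f 1) = 0"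
    using degree_le[of 0 "coeff f 1"] by (simp add: 0)
  ultimately have "f = [:[:coeff (coeff f 0) 0, coeff (coeff f 0) 1:], [:coeff (coeff f 1) 0:]:]"
    by (metis degree_le_1_conv degree_0_id)
  then have "f = cst (coeff (coeff f 1) 0) * varX + cst (coeff (coeff f 0) 1) * varY
      + cst (coeff (coeff f 0) 0)"
    by (simp add: cst_def varX_def varY_def)
  then show ?thesis by blast
qed

lemma total_degree_linear:
  assumes "a \<noteq> 0 \<or> b \<noteq> 0"
  shows "total_degree (cst a * varX + cst b * varY) = 1"
proof -
  have f: "cst a * varX + cst b * varY = [:[:0, b:], [:a:]:]"
    by (simp add: cst_def varX_def varY_def)
  have "coeff (coeff [:[:0, b:], [:a:]:] i) j \<noteq> 0 \<longleftrightarrow>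
      i = 0 \<and> j = 1 \<and> b \<noteq> 0 \<or> i = 1 \<and> j = 0 \<and> a \<noteq> 0" for i j
    by (cases i; cases "i - 1"; cases j; cases "j - 1") simp_all
  then have "{i + j |i j. coeff (coeff [:[:0, b:], [:a:]:] i) j \<noteq> 0}
      = {i + j |i j. i = 0 \<and> j = 1 \<and> b \<noteq> 0 \<or> i = 1 \<and> j = 0 \<and> a \<noteq> 0}"
    by (simp only:)
  also have "\<dots> = {1}"
  proof -
    have "\<exists>i j. 1 = i + j \<and> (i = 0 \<and> j = 1 \<and> b \<noteq> 0 \<or> i = (1 :: nat) \<and> j = 0 \<and> a \<noteq> 0)"
      using assms by (metis add_0 add_0_right)
    then show ?thesis by auto
  qed
  finally show ?thesis
    unfolding total_degree_def f by simp
qed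

lemma affine_imp_linear: "affine_auts \<subseteq> linear_auts"
  by (auto simp: affine_auts_def linear_auts_def intro: total_degree_1_imp_linear)

lemma linear_autE:
  assumes "\<sigma> \<in> (linear_auts :: ('a::idom poly poly \<Rightarrow> _) set)"
  obtains a b c a' b' c' e where "\<sigma> \<in> carrier GA2"
    "\<sigma> varX = cst a * varX + cst b * varY + cst c"
    "\<sigma> varY = cst a' * varX + cst b' * varY + cst c'"
    "e * (a * b' - b * a') = 1"
proof -
  obtain a b c a' b' c' where \<sigma>: "\<sigma> \<in> carrier GA2"
    "\<sigma> varX = cst a * varX + cst b * varY + cst c" "\<sigma> varY = cst a' * varX + cst b' * varY + cst c'"
    using assms by (auto simp: linear_auts_def)
  have "jac (\<sigma> varX) (\<sigma> varY) = cst (a * b' - b * a')"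
    by (simp add: \<sigma> jac_def pderiv_add pderiv_mult pderivY_add pderivY_mult)
  then have "cst (a * b' - b * a') dvd 1"
    using jac_GA2_unit[OF \<sigma>(1)] by metis
  then have "a * b' - b * a' dvd 1"
    by (simp only: cst_def is_unit_const_poly_iff)
  then obtain e where "e * (a * b' - b * a') = 1"
    using unit_cst_dvd by blast
  with \<sigma> show ?thesis by (rule that)
qed

lemma triangular_autE:
  assumes "\<sigma> \<in> (triangular_auts :: ('a::idom poly poly \<Rightarrow> _) set)"
  obtains u Q v c u' v' where "\<sigma> \<in> carrier GA2"
    "\<sigma> varX = cst u * varX + subst Q varY" "\<sigma> varY = cst v * varY + cst c"
    "u' * u = 1" "v' * v = 1" "u \<noteq> 0" "v \<noteq> 0" "u dvd 1" "v dvd 1"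
proof -
  obtain u Q v c where \<sigma>: "\<sigma> \<in> carrier GA2" "\<sigma> varX = cst u * varX + subst Q varY"
    "\<sigma> varY = cst v * varY + cst c" "u dvd 1" "v dvd 1"
    using assms by (auto simp: triangular_auts_def)
  then obtain u' v' where "u' * u = 1" "v' * v = 1"
    using unit_cst_dvd by metis
  moreover from this have "u \<noteq> 0" "v \<noteq> 0" by auto
  ultimately show ?thesis using \<sigma> that by blast
qed

lemma linear_inv:
  assumes "\<sigma> \<in> (linear_auts :: ('a::idom poly poly \<Rightarrow> _) set)"
  shows "inv_into UNIV \<sigma> \<in> linear_auts"
proof -
  obtain a b c a' b' c' e where \<sigma>: "\<sigma> \<in> carrier GA2"
    "\<sigma> varX = cst a * varX + cst b * varY + cst c" "\<sigma> varY = cst a' * varX + cst b' * varY + cst c'"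
    "e * (a * b' - b * a') = 1"
    using assms by (rule linear_autE)
  note hom = alg_hom2_simps[OF GA2_hom[OF \<sigma>(1)]]
  \<comment> \<open>Cramer's rule, with \<open>e\<close> the inverse of the determinant.\<close>
  have eq1: "cst e * (cst b' * (cst a * f + cst b * g) - cst b * (cst a' * f + cst b' * g))
      = cst (e * (a * b' - b * a')) * f"
    "cst e * (cst a * (cst a' * f + cst b' * g) - cst a' * (cst a * f + cst b * g))
      = cst (e * (a * b' - b * a')) * g" for f g
    by (simp_all add: algebra_simps)
  have "\<sigma> (cst e * (cst b' * (varX - cst c) - cst b * (varY - cst c'))) = varX"
    "\<sigma> (cst e * (cst a * (varY - cst c') - cst a' * (varX - cst c))) = varY"
    using eq1[of varX varY] unfolding \<sigma>(4) by (simp_all add: hom \<sigma>(2,3))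
  from this[THEN arg_cong[where f = "inv_into UNIV \<sigma>"]]
  have "inv_into UNIV \<sigma> varX = cst e * (cst b' * (varX - cst c) - cst b * (varY - cst c'))"
    "inv_into UNIV \<sigma> varY = cst e * (cst a * (varY - cst c') - cst a' * (varX - cst c))"
    using \<sigma>(1) by simp_all
  then have "inv_into UNIV \<sigma> varX = cst (e * b') * varX + cst (- (e * b)) * varY + cst (e * (b * c' - b' * c))"
    "inv_into UNIV \<sigma> varY = cst (- (e * a')) * varX + cst (e * a) * varY + cst (e * (a' * c - a * c'))"
    by (simp_all add: algebra_simps)
  then show ?thesis
    unfolding linear_auts_def using GA2_inv[OF \<sigma>(1)] by blast
qed

lemma linear_comp:
  assumes "\<sigma> \<in> (linear_auts :: ('a::idom poly poly \<Rightarrow> _) set)" and "\<tau> \<in> linear_auts"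
  shows "\<sigma> \<circ> \<tau> \<in> linear_auts"
proof -
  obtain a b c a' b' c' where \<sigma>: "\<sigma> \<in> carrier GA2"
    "\<sigma> varX = cst a * varX + cst b * varY + cst c" "\<sigma> varY = cst a' * varX + cst b' * varY + cst c'"
    using assms(1) by (rule linear_autE)
  note hom = alg_hom2_simps[OF GA2_hom[OF \<sigma>(1)]]
  have "\<exists>a b c. \<sigma> f = cst a * varX + cst b * varY + cst c"
    if f: "\<exists>a b c. f = cst a * varX + cst b * varY + cst c" for f
  proof -
    obtain \<alpha> \<beta> \<gamma> where f: "f = cst \<alpha> * varX + cst \<beta> * varY + cst \<gamma>"
      using f by blast
    have "\<sigma> f = cst (\<alpha> * a + \<beta> * a') * varX + cst (\<alpha> * b + \<beta> * b') * varY + cst (\<alpha> * c + \<beta> * c' + \<gamma>)"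
      by (simp add: f hom \<sigma> algebra_simps)
    then show ?thesis by blast
  qed
  then show ?thesis
    using assms by (auto simp: linear_auts_def GA2_comp)
qed

lemma triangular_inv:
  assumes "\<sigma> \<in> (triangular_auts :: ('a::idom poly poly \<Rightarrow> _) set)"
  shows "inv_into UNIV \<sigma> \<in> triangular_auts"
proof -
  obtain u Q v c u' v' where \<sigma>: "\<sigma> \<in> carrier GA2"
    "\<sigma> varX = cst u * varX + subst Q varY" "\<sigma> varY = cst v * varY + cst c"
    "u' * u = 1" "v' * v = 1"
    using assms by (rule triangular_autE)
  note hom = alg_hom2_simps[OF GA2_hom[OF \<sigma>(1)]]
  define k where "k = cst v' * (varY - cst c)"
  have k: "\<sigma> k = varY"
    by (simp add: k_def hom \<sigma> cst_cancel)
  have h: "\<sigma> (cst u' * (varX - subst Q k)) = varX"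
    by (simp add: hom k \<sigma> cst_cancel)
  have "inv_into UNIV \<sigma> varY = k" "inv_into UNIV \<sigma> varX = cst u' * (varX - subst Q k)"
    using k h \<sigma>(1) by (metis GA2_inverses(2))+
  moreover have "k = subst [:- (v' * c), v':] varY"
    by (simp add: k_def subst_pCons algebra_simps)
  ultimately have
    "inv_into UNIV \<sigma> varX = cst u' * varX + subst (smult (- u') (pcompose Q [:- (v' * c), v':])) varY"
    "inv_into UNIV \<sigma> varY = cst v' * varY + cst (- (v' * c))"
    by (simp_all add: subst_pcompose) (simp_all add: subst_pCons algebra_simps)
  moreover have "u' dvd 1" "v' dvd 1"
    using \<sigma>(4,5) by (metis dvd_triv_left)+
  ultimately show ?thesis
    unfolding triangular_auts_def using GA2_inv[OF \<sigma>(1)] by blast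
qed

lemma triangular_comp:
  assumes "\<sigma> \<in> (triangular_auts :: ('a::idom poly poly \<Rightarrow> _) set)" and "\<tau> \<in> triangular_auts"
  shows "\<sigma> \<circ> \<tau> \<in> triangular_auts"
proof -
  obtain u Q v c where \<sigma>: "\<sigma> \<in> carrier GA2" "u dvd 1" "v dvd 1"
    "\<sigma> varX = cst u * varX + subst Q varY" "\<sigma> varY = cst v * varY + cst c"
    using assms(1) by (rule triangular_autE)
  obtain u2 Q2 v2 c2 where \<tau>: "\<tau> \<in> carrier GA2" "u2 dvd 1" "v2 dvd 1"
    "\<tau> varX = cst u2 * varX + subst Q2 varY" "\<tau> varY = cst v2 * varY + cst c2"
    using assms(2) by (rule triangular_autE)
  note hom = alg_hom2_simps[OF GA2_hom[OF \<sigma>(1)]]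
  have "\<sigma> varY = subst [:c, v:] varY"
    by (simp add: \<sigma> subst_pCons algebra_simps)
  then have "(\<sigma> \<circ> \<tau>) varX = cst (u2 * u) * varX + subst (smult u2 Q + pcompose Q2 [:c, v:]) varY"
    by (simp add: \<tau> hom \<sigma>(4) subst_pcompose algebra_simps)
  moreover have "(\<sigma> \<circ> \<tau>) varY = cst (v2 * v) * varY + cst (v2 * c + c2)"
    by (simp add: \<tau> hom \<sigma>(5) algebra_simps)
  moreover have "u2 * u dvd 1" "v2 * v dvd 1"
    using mult_dvd_mono[OF \<tau>(2) \<sigma>(2)] mult_dvd_mono[OF \<tau>(3) \<sigma>(3)] by simp_all
  ultimately show ?thesis
    unfolding triangular_auts_def using GA2_comp[OF \<sigma>(1) \<tau>(1)] by blast
qed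

text \<open>Keeps a letter outside the affine group when a factor lying in both groups is absorbed
  into it.\<close>

lemma cancel_linear:
  assumes "t \<circ> t' \<in> (linear_auts :: ('a::idom poly poly \<Rightarrow> _) set)" "t' \<in> linear_auts"
  shows "t \<in> linear_auts"
proof -
  have "t' \<in> carrier GA2"
    using assms(2) by (simp add: linear_auts_def)
  then have "(t \<circ> t') \<circ> inv_into UNIV t' = t"
    by (simp add: comp_assoc GA2_comp_inverses)
  then show ?thesis
    using linear_comp[OF assms(1) linear_inv[OF assms(2)]] by simp
qed

text \<open>Words alternating between the two factors of the amalgamated product, by last letter.\<close>
inductive ends_triangular ends_linear :: "('a::idom poly poly \<Rightarrow> 'a poly poly) \<Rightarrow> bool" where
  tri: "t \<in> triangular_auts \<Longrightarrow> ends_triangular t"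
| lin_tri: "ends_linear s \<Longrightarrow> t \<in> triangular_auts - linear_auts \<Longrightarrow> ends_triangular (s \<circ> t)"
| tri_lin: "ends_triangular t \<Longrightarrow> a \<in> linear_auts - triangular_auts \<Longrightarrow> ends_linear (t \<circ> a)"

text \<open>If \<open>a\<close> is also triangular it is absorbed into the last letter; otherwise it
  becomes a new letter.\<close>

lemma ends_triangular_comp_linear:
  assumes "ends_triangular w" "a \<in> linear_auts"
  shows "ends_triangular (w \<circ> a) \<or> ends_linear (w \<circ> a)"
proof (cases "a \<in> triangular_auts")
  case True
  from assms(1) show ?thesis
  proof cases
    case tri
    then show ?thesis
      using True by (auto intro: ends_triangular_ends_linear.tri triangular_comp)
  next
    case (lin_tri s t)
    then have "t \<circ> a \<in> triangular_auts - linear_auts"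
      using True assms(2) triangular_comp cancel_linear by blast
    then show ?thesis
      using lin_tri by (auto simp: comp_assoc intro: ends_triangular_ends_linear.lin_tri)
  qed
next
  case False
  then show ?thesis
    using assms by (auto intro: tri_lin)
qed

text \<open>The two affine letters merge, and their product is appended to the shorter word, where
  the preceding lemma decides whether it stays a letter.\<close>

lemma ends_linear_comp_linear:
  assumes "ends_linear w" "a \<in> linear_auts"
  shows "ends_triangular (w \<circ> a) \<or> ends_linear (w \<circ> a)"
  using assms(1)
proof cases
  case (tri_lin t b)
  then show ?thesis
    using ends_triangular_comp_linear[of t "b \<circ> a"] assms(2)
    by (simp add: comp_assoc linear_comp)
qed

lemma ends_linear_comp_triangular:
  assumes "ends_linear w" "t \<in> triangular_auts"
  shows "ends_triangular (w \<circ> t) \<or> ends_linear (w \<circ> t)"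
  using ends_linear_comp_linear[OF assms(1)] lin_tri[OF assms(1)] assms(2)
  by blast

lemma ends_triangular_comp_triangular:
  assumes "ends_triangular w" "t \<in> triangular_auts"
  shows "ends_triangular (w \<circ> t) \<or> ends_linear (w \<circ> t)"
  using assms(1)
proof cases
  case tri
  then show ?thesis
    using assms(2) by (auto intro: ends_triangular_ends_linear.tri triangular_comp)
next
  case (lin_tri s t')
  then show ?thesis
    using ends_linear_comp_triangular[of s "t' \<circ> t"] assms(2)
    by (simp add: comp_assoc triangular_comp)
qed

lemma TA2_normal_form:
  fixes w :: "'a::idom poly poly \<Rightarrow> 'a poly poly"
  assumes "w \<in> TA2"
  shows "ends_triangular w \<or> ends_linear w"
proof -
  have step: "ends_triangular (v \<circ> s) \<or> ends_linear (v \<circ> s)"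
    if "ends_triangular v \<or> ends_linear v" "s \<in> linear_auts \<union> triangular_auts"
    for v s :: "'a poly poly \<Rightarrow> 'a poly poly"
    using that ends_triangular_comp_linear ends_linear_comp_linear
      ends_triangular_comp_triangular ends_linear_comp_triangular by blast
  \<comment> \<open>Allowing an arbitrary prefix \<open>v\<close> lets the product case of the
    induction append its factors in turn.\<close>
  have "ends_triangular v \<or> ends_linear v \<longrightarrow> ends_triangular (v \<circ> w) \<or> ends_linear (v \<circ> w)"
    for v
    using assms unfolding TA2_def
  proof (induction arbitrary: v rule: generate.induct)
    case one
    then show ?case by simp
  next
    case (incl h)
    then show ?case using step affine_imp_linear by blast
  next
    case (inv h)
    then have h: "h \<in> linear_auts \<union> triangular_auts"
      using affine_imp_linear by blast
    then have carrier: "h \<in> carrier GA2"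
      by (auto simp: linear_auts_def triangular_auts_def)
    have "inv_into UNIV h \<in> linear_auts \<union> triangular_auts"
      using h linear_inv triangular_inv by blast
    then show ?case
      unfolding GA2_simps m_inv_GA2[OF carrier] using step by blast
  next
    case (eng h1 h2)
    then show ?case
      unfolding GA2_simps comp_assoc[symmetric] by blast
  qed
  moreover have "ends_triangular (id :: 'a poly poly \<Rightarrow> _)"
  proof (rule tri)
    have "id varX = cst 1 * varX + subst 0 (varY :: 'a poly poly)"
      "id varY = cst 1 * varY + cst (0 :: 'a)"
      by simp_all
    then show "(id :: 'a poly poly \<Rightarrow> _) \<in> triangular_auts"
      unfolding triangular_auts_def using GA2_id dvd_refl[of "1 :: 'a"] by blast
  qed
  ultimately show ?thesis
    by (metis id_comp)
qed

section \<open>Degrees in x along a reduced word\<close>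

lemma degree_cst_mult: "c \<noteq> 0 \<Longrightarrow> degree (cst c * f) = degree f"
  for f :: "'a::idom poly poly"
  by (simp add: cst_def)

lemma degree_cst_mult_le: "degree (cst c * f) \<le> degree f"
  for f :: "'a::idom poly poly"
  by (simp add: cst_def)

lemma degree_cst [simp]: "degree (cst c) = 0"
  by (simp add: cst_def)

lemma degree_linear_comb:
  fixes f g :: "'a::idom poly poly"
  assumes "a \<noteq> 0" "degree g < degree f"
  shows "degree (cst a * f + cst b * g + cst c) = degree f"
proof -
  have "degree (cst b * g + cst c) \<le> degree g"
    using degree_cst_mult_le[of b g] by (intro degree_add_le) simp_all
  then have "degree (cst a * f + (cst b * g + cst c)) = degree f"
    using assms by (subst degree_add_eq_left) (simp_all add: degree_cst_mult)
  then show ?thesis by (simp add: add.assoc)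
qed

text \<open>If \<gamma> were 0, the determinant \<alpha>\<delta> would be a unit, so \<alpha> and
  \<delta> would be units and \<open>a\<close> triangular.\<close>

lemma linear_not_triangularE:
  fixes a :: "'a::idom poly poly \<Rightarrow> 'a poly poly"
  assumes "a \<in> linear_auts - triangular_auts"
  obtains \<alpha> \<beta> c \<gamma> \<delta> d where "a \<in> carrier GA2"
    "a varX = cst \<alpha> * varX + cst \<beta> * varY + cst c"
    "a varY = cst \<gamma> * varX + cst \<delta> * varY + cst d" "\<gamma> \<noteq> 0"
proof -
  obtain \<alpha> \<beta> c \<gamma> \<delta> d e where a: "a \<in> carrier GA2"
    "a varX = cst \<alpha> * varX + cst \<beta> * varY + cst c"
    "a varY = cst \<gamma> * varX + cst \<delta> * varY + cst d" "e * (\<alpha> * \<delta> - \<beta> * \<gamma>) = 1"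
    using assms by (auto elim: linear_autE)
  have "\<gamma> \<noteq> 0"
  proof
    assume "\<gamma> = 0"
    then have "1 = e * \<alpha> * \<delta>"
      using a(4) by (simp add: mult.assoc)
    then have "\<alpha> dvd 1" "\<delta> dvd 1"
      by (metis dvd_triv_left dvd_triv_right dvd_mult_left mult.commute mult.assoc)+
    moreover have "a varX = cst \<alpha> * varX + subst [:c, \<beta>:] varY" "a varY = cst \<delta> * varY + cst d"
      using a \<open>\<gamma> = 0\<close> by (simp_all add: subst_pCons algebra_simps)
    ultimately show False
      using assms a(1) unfolding triangular_auts_def by blast
  qed
  then show ?thesis using a that by blast
qed

lemma triangular_not_linearE:
  fixes t :: "'a::idom poly poly \<Rightarrow> 'a poly poly"
  assumes "t \<in> triangular_auts - linear_auts"
  obtains u S v c where "t \<in> carrier GA2"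
    "t varX = cst u * varX + subst S varY" "t varY = cst v * varY + cst c"
    "u \<noteq> 0" "v \<noteq> 0" "degree S \<ge> 2"
proof -
  obtain u S v c where t: "t \<in> carrier GA2" "u \<noteq> 0" "v \<noteq> 0"
    "t varX = cst u * varX + subst S varY" "t varY = cst v * varY + cst c"
    using assms by (auto elim: triangular_autE)
  have "degree S \<ge> 2"
  proof (rule ccontr)
    assume "\<not> degree S \<ge> 2"
    then have "S = [:coeff S 0, coeff S 1:]"
      by (intro degree_le_1_conv) simp
    then have "subst S varY = cst (coeff S 1) * varY + cst (coeff S 0)"
      by (metis add.commute add.right_neutral mult.commute mult_zero_right subst_0 subst_pCons)
    then have "t varX = cst u * varX + cst (coeff S 1) * varY + cst (coeff S 0)"
      "t varY = cst 0 * varX + cst v * varY + cst c"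
      using t by (simp_all add: add.assoc)
    then show False
      using assms t(1) unfolding linear_auts_def by blast
  qed
  then show ?thesis using t that by blast
qed

text \<open>A triangular letter with deg \<open>S\<close> at least 2 makes the first component
  strictly dominant in degree; an affine letter with \<gamma> nonzero passes this degree to the
  second. The bound 1 \<le> deg keeps the next growth strict.\<close>

lemma ends_degrees:
  fixes w :: "'a::idom poly poly \<Rightarrow> 'a poly poly"
  shows "ends_triangular w \<Longrightarrow> w \<in> carrier GA2 \<and> degree (w varY) < degree (w varX)"
    and "ends_linear w \<Longrightarrow>
      w \<in> carrier GA2 \<and> degree (w varX) \<le> degree (w varY) \<and> 1 \<le> degree (w varY)"
proof (induction rule: ends_triangular_ends_linear.inducts)
  case (tri t)
  then obtain u Q v c where t: "t \<in> carrier GA2" "u \<noteq> 0"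
    "t varX = cst u * varX + subst Q varY" "t varY = cst v * varY + cst c"
    by (auto elim: triangular_autE)
  then show ?case
    unfolding t(3,4) subst_varY by (simp add: cst_def varX_def varY_def)
next
  case (lin_tri s t)
  then have "t \<in> triangular_auts - linear_auts"
    by simp
  then obtain u S v c where t: "t \<in> carrier GA2"
    "t varX = cst u * varX + subst S varY" "t varY = cst v * varY + cst c"
    "u \<noteq> 0" "v \<noteq> 0" "degree S \<ge> 2"
    by (rule triangular_not_linearE)
  from lin_tri have s: "s \<in> carrier GA2" "degree (s varX) \<le> degree (s varY)" "1 \<le> degree (s varY)"
    by simp_all
  note hom = alg_hom2_simps[OF GA2_hom[OF s(1)]]
  have lt: "degree (s varY) < degree S * degree (s varY)"
    using t(6) s(3) by simp
  have "degree (cst u * s varX) \<le> degree (s varY)"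
    using degree_cst_mult_le[of u "s varX"] s(2) by linarith
  then have "degree (cst u * s varX) < degree S * degree (s varY)"
    using lt by (rule le_less_trans)
  then have "degree (s (t varX)) = degree S * degree (s varY)"
    unfolding t hom by (subst degree_add_eq_right) (simp_all only: degree_subst)
  moreover have "degree (s (t varY)) \<le> degree (s varY)"
    unfolding t hom using degree_cst_mult_le by (intro degree_add_le) simp_all
  then have "degree (s (t varY)) < degree S * degree (s varY)"
    using lt by (rule le_less_trans)
  ultimately show ?case
    using GA2_comp[OF s(1) t(1)] by (metis comp_apply)
next
  case (tri_lin t a)
  then have "a \<in> linear_auts - triangular_auts"
    by simp
  then obtain \<alpha> \<beta> c \<gamma> \<delta> d where a: "a \<in> carrier GA2"
    "a varX = cst \<alpha> * varX + cst \<beta> * varY + cst c"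
    "a varY = cst \<gamma> * varX + cst \<delta> * varY + cst d" "\<gamma> \<noteq> 0"
    by (rule linear_not_triangularE)
  from tri_lin have t: "t \<in> carrier GA2" "degree (t varY) < degree (t varX)"
    by simp_all
  note hom = alg_hom2_simps[OF GA2_hom[OF t(1)]]
  have "degree (t (a varY)) = degree (t varX)"
    unfolding a hom by (rule degree_linear_comb[OF a(4) t(2)])
  moreover have "degree (t (a varX)) \<le> degree (t varX)"
    unfolding a hom using t(2) degree_cst_mult_le[of \<alpha> "t varX"] degree_cst_mult_le[of \<beta> "t varY"]
    by (intro degree_add_le) simp_all
  ultimately show ?case
    using GA2_comp[OF t(1) a(1)] t(2) by (metis comp_apply less_eq_Suc_le One_nat_def not_gr_zero not_less_zero)
qed

text \<open>The coefficients of x and y in the two components form an invertible matrix. Removing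
  the corresponding linear automorphism \<open>\<mu>\<close> leaves a triangular
  \<open>\<rho>\<close>, so \<sigma> is the composite of \<open>\<rho>\<close> and
  \<open>\<mu>\<close>.\<close>

lemma B1_components_imp_tame:
  fixes \<sigma> :: "'a::idom poly poly \<Rightarrow> 'a poly poly"
  assumes \<sigma>: "\<sigma> \<in> carrier GA2" and B1: "\<sigma> varX \<in> B1" "\<sigma> varY \<in> B1"
  shows "\<sigma> \<in> TA2"
proof -
  obtain p Q p' Q' where x: "\<sigma> varX = cst p * varX + subst Q varY"
    and y: "\<sigma> varY = cst p' * varX + subst Q' varY"
    using B1 by (auto simp: B1_def)
  define q q' where "q = coeff Q 1" and "q' = coeff Q' 1"
  have "jac (\<sigma> varX) (\<sigma> varY)
      = cst p * subst (pderiv Q') varY - subst (pderiv Q) varY * cst p'"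
    by (simp add: x y jac_def pderiv_add pderiv_mult pderivY_add pderivY_mult pderiv_subst)
  also have "\<dots> = [:smult p (pderiv Q') - smult p' (pderiv Q):]"
    by (simp add: subst_varY cst_def mult.commute)
  finally obtain d where "smult p (pderiv Q') - smult p' (pderiv Q) = [:d:]" "d dvd 1"
    using jac_GA2_unit[OF \<sigma>] by (metis is_unit_const_poly_iff is_unit_poly_iff)
  \<comment> \<open>The Jacobian is a unit constant; its value at y = 0 is the determinant of the
    linear coefficients.\<close>
  from arg_cong[OF this(1), of "\<lambda>f. coeff f 0"] this(2)
  obtain e where e: "e * (p * q' - p' * q) = 1"
    using unit_cst_dvd[of d] by (auto simp: q_def q'_def coeff_pderiv)
  define h k where "h = cst e * (cst q' * varX - cst q * varY)"
    and "k = cst e * (cst p * varY - cst p' * varX)"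
  define \<mu> where "\<mu> = endo (cst p * varX + cst q * varY) (cst p' * varX + cst q' * varY)"
  have eqs: "cst e * (cst q' * (cst p * f + cst q * g) - cst q * (cst p' * f + cst q' * g))
      = cst (e * (p * q' - p' * q)) * f"
    "cst e * (cst p * (cst p' * f + cst q' * g) - cst p' * (cst p * f + cst q * g))
      = cst (e * (p * q' - p' * q)) * g"
    "cst p * (cst e * (cst q' * f - cst q * g)) + cst q * (cst e * (cst p * g - cst p' * f))
      = cst (e * (p * q' - p' * q)) * f"
    "cst p' * (cst e * (cst q' * f - cst q * g)) + cst q' * (cst e * (cst p * g - cst p' * f))
      = cst (e * (p * q' - p' * q)) * g" for f g
    by (simp_all add: algebra_simps)
  have \<mu>hk: "\<mu> h = varX" "\<mu> k = varY" and hk\<mu>: "endo h k (\<mu> varX) = varX" "endo h k (\<mu> varY) = varY"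
    using eqs[of varX varY] unfolding e by (simp_all add: \<mu>_def h_def k_def)
  have \<mu>: "\<mu> \<in> carrier GA2" and hk: "endo h k \<in> carrier GA2"
    using \<mu>hk hk\<mu> unfolding \<mu>_def by (auto intro!: GA2_endoI simp: \<mu>_def)
  have "\<not> (p = 0 \<and> q = 0)" "\<not> (p' = 0 \<and> q' = 0)"
    using e by auto
  then have "\<mu> \<in> affine_auts"
    unfolding affine_auts_def using \<mu> by (simp add: \<mu>_def total_degree_linear)
  define \<rho> where "\<rho> = \<sigma> \<circ> endo h k"
  have \<rho>: "\<rho> \<in> carrier GA2"
    unfolding \<rho>_def by (rule GA2_comp[OF \<sigma> hk])
  note hom = alg_hom2_simps[OF GA2_hom[OF \<sigma>]]
  define S W where "S = smult e (smult q' Q - smult q Q')" and "W = smult e (smult p Q' - smult p' Q)"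
  have "\<rho> varX = cst (e * (p * q' - p' * q)) * varX + subst S varY"
    by (simp add: \<rho>_def h_def hom x y S_def algebra_simps)
  then have \<rho>x: "\<rho> varX = cst 1 * varX + subst S varY"
    unfolding e .
  have \<rho>y: "\<rho> varY = subst W varY"
    by (simp add: \<rho>_def k_def hom x y W_def algebra_simps)
  \<comment> \<open>\<open>\<rho>\<close> sends y to W(y); inverting and setting x = 0 gives W(V(0,
    y)) = y, so \<open>W\<close> has degree 1 with unit leading coefficient.\<close>
  define V where "V = inv_into UNIV \<rho> varY"
  have "varY = inv_into UNIV \<rho> (\<rho> varY)"
    using \<rho> by simp
  also have "\<dots> = subst W V"
    unfolding \<rho>y V_def by (rule alg_hom2_subst[OF GA2_hom[OF GA2_inv[OF \<rho>]]])
  finally have "coeff varY 0 = coeff (subst W V) 0"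
    by simp
  then have WV: "pcompose W (coeff V 0) = [:0, 1:]"
    by (simp add: varY_def coeff_subst_0)
  from arg_cong[OF this, of degree] have "degree W * degree (coeff V 0) = 1"
    by (simp add: degree_pcompose)
  then have "W = [:coeff W 0, coeff W 1:]"
    by (intro degree_le_1_conv) simp
  then obtain w0 w1 where W: "W = [:w0, w1:]" by blast
  have "1 = w1 * coeff (coeff V 0) 1"
    using arg_cong[OF WV, of "\<lambda>f. coeff f 1"] by (simp add: W pcompose_pCons mult.commute)
  then have "w1 dvd 1" ..
  moreover have "\<rho> varY = cst w1 * varY + cst w0"
    by (simp add: \<rho>y W subst_pCons algebra_simps)
  ultimately have "\<rho> \<in> triangular_auts"
    unfolding triangular_auts_def using \<rho> \<rho>x dvd_refl[of "1 :: 'a"] by blast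
  moreover have "endo h k \<circ> \<mu> = id"
    using hk\<mu> by (intro alg_hom2_eqI alg_hom2_comp alg_hom2_endo alg_hom2_id)
      (simp_all add: \<mu>_def alg_hom2_endo)
  then have "\<sigma> = \<rho> \<circ> \<mu>"
    by (simp add: \<rho>_def comp_assoc)
  ultimately show ?thesis
    using \<open>\<mu> \<in> affine_auts\<close> generate.eng[of \<rho> GA2 "affine_auts \<union> triangular_auts" \<mu>]
    unfolding TA2_def by (simp add: generate.incl)
qed

lemma shear_in_GA2: "endo (varX + cst k * varY) varY \<in> carrier GA2"
  by (rule GA2_endoI[where h = "varX - cst k * varY" and k = varY]) simp_all

context reduced_quadruplet
begin

text \<open>Only the last three letters of the reduced word matter: before them stands an
  automorphism \<open>s\<close> whose second component is \<open>A\<close> up to an affine change.\<close>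
lemma tame_imp_B1_components:
  assumes "tame F"
  shows "\<exists>\<sigma>\<in>carrier GA2. \<exists>\<tau>\<in>carrier GA2.
    \<sigma> varX \<in> B1 \<and> \<sigma> varY \<in> B1 \<and> \<tau> varX \<in> B1 \<and> \<tau> varY \<in> B1 \<and> \<sigma> (\<tau> varY) = F"
proof -
  obtain w where w: "w \<in> TA2" "w varY = F"
    using assms by (auto simp: tame_def)
  \<comment> \<open>The word may be assumed to end in an affine \<open>b\<close> with \<gamma>
    nonzero, since only the image of y matters.\<close>
  have "\<exists>t b \<alpha> \<beta> c \<gamma> \<delta> d. ends_triangular t \<and> b \<in> carrier GA2 \<and> \<gamma> \<noteq> 0 \<and> F = t (b varY)
    \<and> b varX = cst \<alpha> * varX + cst \<beta> * varY + cst c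
    \<and> b varY = cst \<gamma> * varX + cst \<delta> * varY + cst d"
    using TA2_normal_form[OF w(1)]
  proof
    assume "ends_linear w"
    then show ?thesis
    proof cases
      case (tri_lin t a)
      obtain \<alpha> \<beta> c \<gamma> \<delta> d where a: "a \<in> carrier GA2"
        "a varX = cst \<alpha> * varX + cst \<beta> * varY + cst c"
        "a varY = cst \<gamma> * varX + cst \<delta> * varY + cst d" "\<gamma> \<noteq> 0"
        using tri_lin(3) by (rule linear_not_triangularE)
      have "F = t (a varY)"
        using w(2) tri_lin(1) by simp
      with a tri_lin(2) show ?thesis by blast
    qed
  next
    assume "ends_triangular w"
    then show ?thesis
    proof cases
      case tri
      then obtain v c where "w varY = cst v * varY + cst c"
        by (auto elim: triangular_autE)
      then have "degree F = 0"
        by (simp add: w(2)[symmetric] cst_def varY_def)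
      then show ?thesis
        using degree_F degree_Q2 by simp
    next
      case (lin_tri s t')
      then obtain v e v' where t': "t' varY = cst v * varY + cst e" "v \<noteq> 0" "v' * v = 1"
        by (auto elim: triangular_autE)
      from lin_tri(2) show ?thesis
      proof cases
        case (tri_lin t a)
        obtain \<alpha> \<beta> c \<gamma> \<delta> d where a: "a \<in> carrier GA2"
          "a varX = cst \<alpha> * varX + cst \<beta> * varY + cst c"
          "a varY = cst \<gamma> * varX + cst \<delta> * varY + cst d" "\<gamma> \<noteq> 0"
          using tri_lin(3) by (rule linear_not_triangularE)
        note hom = alg_hom2_simps[OF GA2_hom[OF a(1)]]
        \<comment> \<open>A final triangular letter acts on y by v y + e; replacing it by (x, v y +
          e) keeps \<open>F\<close> and merges with \<open>a\<close>.\<close>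
        define b where "b = a \<circ> endo varX (cst v * varY + cst e)"
        have vv: "cst v' * cst v = 1" "cst v * cst v' = 1"
          using t'(3) by (metis cst_1 cst_simps(5) mult.commute)+
        have "endo varX (cst v * varY + cst e) \<in> carrier GA2"
          by (intro GA2_endoI[where h = varX and k = "cst v' * (varY - cst e)"])
            (simp_all add: vv algebra_simps flip: mult.assoc)
        then have "b \<in> carrier GA2"
          unfolding b_def by (rule GA2_comp[OF a(1)])
        moreover have "b varX = cst \<alpha> * varX + cst \<beta> * varY + cst c"
          by (simp add: b_def a)
        moreover have "b varY = cst (v * \<gamma>) * varX + cst (v * \<delta>) * varY + cst (v * d + e)"
          by (simp add: b_def hom a algebra_simps)
        moreover have "v * \<gamma> \<noteq> 0"
          using t'(2) a(4) by simp
        moreover have "F = t (b varY)"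
          using w(2) lin_tri(1) tri_lin(1) by (simp add: b_def t')
        ultimately show ?thesis
          using tri_lin(2) by blast
      qed
    qed
  qed
  then obtain t b \<alpha> \<beta> c \<gamma> \<delta> d where t: "ends_triangular t"
    and b: "b \<in> carrier GA2" "b varX = cst \<alpha> * varX + cst \<beta> * varY + cst c"
      "b varY = cst \<gamma> * varX + cst \<delta> * varY + cst d"
    and \<gamma>: "\<gamma> \<noteq> 0" and F: "F = t (b varY)"
    by blast
  note t_deg = ends_degrees(1)[OF t]
  have "degree F = degree (t varX)"
    unfolding F b alg_hom2_simps[OF GA2_hom[OF t_deg[THEN conjunct1]]]
    by (rule degree_linear_comb[OF \<gamma> t_deg[THEN conjunct2]])
  then have t_deg_x: "degree (t varX) = degree Q2"
    by (simp add: degree_F)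
  \<comment> \<open>A single triangular letter would give \<open>t varX\<close> degree at most 1,
    against deg \<open>Q2\<close> at least 2, so an affine letter precedes
    \<open>\<theta>\<close>.\<close>
  from t obtain s \<theta> where t_eq: "t = s \<circ> \<theta>" and s: "ends_linear s"
    and \<theta>: "\<theta> \<in> triangular_auts - linear_auts"
  proof cases
    case tri
    then obtain u Q where "t varX = cst u * varX + subst Q varY"
      by (auto elim: triangular_autE)
    then have "degree (t varX) \<le> 1"
      by (simp add: cst_def varX_def subst_varY)
    then show ?thesis
      using t_deg_x degree_Q2 by simp
  next
    case (lin_tri s \<theta>)
    then show ?thesis using that by blast
  qed
  obtain u S v e where \<theta>: "\<theta> \<in> carrier GA2" "\<theta> varX = cst u * varX + subst S varY"
    "\<theta> varY = cst v * varY + cst e" "u \<noteq> 0" "v \<noteq> 0" "degree S \<ge> 2"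
    using \<theta> by (rule triangular_not_linearE)
  have s: "s \<in> carrier GA2" "degree (s varX) \<le> degree (s varY)" "1 \<le> degree (s varY)"
    using ends_degrees(2)[OF s] by simp_all
  note hom_s = alg_hom2_simps[OF GA2_hom[OF s(1)]]
  note hom_\<theta> = alg_hom2_simps[OF GA2_hom[OF \<theta>(1)]]
  define \<psi> where "\<psi> = \<theta> \<circ> b"
  \<comment> \<open>\<open>H\<close> collects the part in y of the image under
    \<open>\<theta>\<close> of the affine form \<alpha> x + \<beta> y + c.\<close>
  define H where "H \<alpha> \<beta> c = smult \<alpha> S + [:\<beta> * e + c, \<beta> * v:]" for \<alpha> \<beta> c
  have \<theta>_lin: "\<theta> (cst \<alpha> * varX + cst \<beta> * varY + cst c) = cst (\<alpha> * u) * varX + subst (H \<alpha> \<beta> c) varY"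
    for \<alpha> \<beta> c
    by (simp add: hom_\<theta> \<theta>(2,3) H_def) (simp add: subst_pCons algebra_simps)
  have \<psi>x: "\<psi> varX = cst (\<alpha> * u) * varX + subst (H \<alpha> \<beta> c) varY"
    and \<psi>y: "\<psi> varY = cst (\<gamma> * u) * varX + subst (H \<gamma> \<delta> d) varY"
    by (simp_all only: \<psi>_def comp_apply b \<theta>_lin)
  have F\<psi>: "F = s (\<psi> varY)"
    by (simp add: F t_eq \<psi>_def)
  then have F_s: "F = cst (\<gamma> * u) * s varX + subst (H \<gamma> \<delta> d) (s varY)"
    by (simp add: \<psi>y hom_s del: cst_simps(5))
  have "degree (t varY) = degree (s varY)"
  proof -
    have "t varY = cst v * s varY + cst 0 * 0 + cst e"
      by (simp add: t_eq \<theta> hom_s)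
    also have "degree \<dots> = degree (s varY)"
      using \<theta>(5) s(3) by (intro degree_linear_comb) simp_all
    finally show ?thesis .
  qed
  then have "degree (s varY) < degree Q2"
    using t_deg t_deg_x by simp
  then obtain c1 h where c1: "c1 dvd 1" and sy: "s varY = cst c1 * A + cst h"
    using second_component_eq_A[OF s(1) F_s] \<gamma> \<theta>(4) by auto
  have "c1 \<noteq> 0"
    using c1 by auto
  then have sy_B1: "s varY \<in> B1"
  proof -
    have "s varY = cst (c1 * p1) * varX + subst (smult c1 Q1 + [:h:]) varY"
      by (simp add: sy A_def algebra_simps)
    then show ?thesis
      using \<open>c1 \<noteq> 0\<close> p1_nz unfolding B1_def by (metis (mono_tags, lifting) mem_Collect_eq mult_eq_0_iff)
  qed
  then have sx_deg: "degree (s varX) \<le> 1"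
    using s(2) by (simp add: B1_iff)
  have "degree (coeff (s varX) 1) = 0"
  proof -
    \<comment> \<open>Comparing the two expressions for \<open>F\<close> gives \<gamma> u s(x) = p2
      y + T(A). As s(x) has degree at most 1 in x, \<open>T\<close> has degree at most 1, so the
      coefficient of x in s(x) is constant.\<close>
    define T where "T = Q2 - pcompose (fract_poly (H \<gamma> \<delta> d)) [:to_fract h, to_fract c1:]"
    have "fract_poly2 (s varY) = subst [:to_fract h, to_fract c1:] (fract_poly2 A)"
      by (simp add: sy subst_pCons algebra_simps)
    then have "cst p2 * varY + subst Q2 (fract_poly2 A)
        = cst (to_fract (\<gamma> * u)) * fract_poly2 (s varX)
          + subst (pcompose (fract_poly (H \<gamma> \<delta> d)) [:to_fract h, to_fract c1:]) (fract_poly2 A)"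
      using arg_cong[OF F_s, of fract_poly2] unfolding fract_F_A
      by (simp add: subst_pcompose del: cst_simps(5) to_fract_mult)
    then have eq: "cst (to_fract (\<gamma> * u)) * fract_poly2 (s varX)
        = cst p2 * varY + subst T (fract_poly2 A)"
      unfolding T_def subst_diff by (simp only: algebra_simps)
    have eq': "subst T (fract_poly2 A)
        = cst (to_fract (\<gamma> * u)) * fract_poly2 (s varX) - cst p2 * varY"
      unfolding eq by simp
    have "degree (subst T (fract_poly2 A)) \<le> 1"
      unfolding eq' using sx_deg degree_cst_mult_le[of "to_fract (\<gamma> * u)" "fract_poly2 (s varX)"]
      by (intro degree_diff_le) (simp_all add: varY_def cst_def)
    then have "degree T \<le> 1"
      by (simp add: degree_subst degree_A)
    then have "T = [:coeff T 0, coeff T 1:]"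
      by (rule degree_le_1_conv)
    then obtain t0 t1 where T: "T = [:t0, t1:]" by blast
    have "coeff (fract_poly2 A) 1 = [:to_fract p1:]"
      unfolding fract_A by (simp add: cst_def varX_def subst_varY)
    then have "smult (to_fract (\<gamma> * u)) (fract_poly (coeff (s varX) 1)) = [:t1 * to_fract p1:]"
      using arg_cong[OF eq, of "\<lambda>f. coeff f 1"]
      by (simp add: T subst_pCons coeff_map_poly cst_def varY_def mult.commute)
    from arg_cong[OF this, of degree] show ?thesis
      using \<gamma> \<theta>(4) by (simp add: degree_map_poly)
  qed
  then obtain r where r: "coeff (s varX) 1 = [:r:]"
    by (metis degree_eq_zeroE)
  have sx: "s varX = cst r * varX + subst (coeff (s varX) 0) varY"
    using degree_le_1_conv[OF sx_deg] unfolding r by (simp add: cst_def varX_def subst_varY)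
  obtain m M where m: "m \<noteq> 0" "s varY = cst m * varX + subst M varY"
    using sy_B1 by (auto simp: B1_def)
  \<comment> \<open>If x does not occur in s(x), adding s(y) makes its coefficient nonzero;
    \<open>k'\<close> does the same for \<open>\<psi>\<close>.\<close>
  define k where "k = (if r = 0 then 1 else 0 :: 'a)"
  have "r + k * m \<noteq> 0"
    using m(1) by (simp add: k_def)
  define \<sigma> where "\<sigma> = s \<circ> endo (varX + cst k * varY) varY"
  have \<sigma>: "\<sigma> \<in> carrier GA2"
    unfolding \<sigma>_def by (rule GA2_comp[OF s(1) shear_in_GA2])
  have "\<sigma> varX = cst (r + k * m) * varX + subst (coeff (s varX) 0 + smult k M) varY"
    by (simp add: \<sigma>_def hom_s) (subst sx, simp add: m algebra_simps)
  then have \<sigma>x: "\<sigma> varX \<in> B1"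
    using \<open>r + k * m \<noteq> 0\<close> unfolding B1_def by blast
  have \<sigma>y: "\<sigma> varY \<in> B1"
    using sy_B1 by (simp add: \<sigma>_def)
  define k' where "k' = (if \<alpha> = 0 then 1 else 0 :: 'a)"
  have k': "(\<alpha> + k' * \<gamma>) * u \<noteq> 0"
    using \<gamma> \<theta>(4) by (simp add: k'_def)
  \<comment> \<open>\<open>sh\<close> undoes the shear inside \<open>\<sigma>\<close>, and the last
    shear in \<open>\<tau>\<close> fixes y, so the composite still sends y to
    \<open>F\<close>.\<close>
  define sh where "sh = endo (varX + cst (- k) * varY) varY"
  define \<tau> where "\<tau> = sh \<circ> (\<psi> \<circ> endo (varX + cst k' * varY) varY)"
  have \<psi>: "\<psi> \<in> carrier GA2"
    unfolding \<psi>_def by (rule GA2_comp[OF \<theta>(1) b(1)])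
  note hom_\<psi> = alg_hom2_simps[OF GA2_hom[OF \<psi>]]
  have \<tau>: "\<tau> \<in> carrier GA2"
    unfolding \<tau>_def sh_def by (intro GA2_comp shear_in_GA2 \<psi>)
  have sh_B1: "sh (cst a * varX + subst K varY) \<in> B1" if "a \<noteq> 0" for a K
  proof -
    have "sh (cst a * varX + subst K varY) = cst a * varX + subst (K + [:0, - (a * k):]) varY"
      by (simp add: sh_def algebra_simps) (simp add: subst_pCons algebra_simps)
    then show ?thesis
      using that unfolding B1_def by blast
  qed
  have "\<tau> varX = sh (cst ((\<alpha> + k' * \<gamma>) * u) * varX + subst (H \<alpha> \<beta> c + smult k' (H \<gamma> \<delta> d)) varY)"
    unfolding \<tau>_def by (simp add: hom_\<psi> \<psi>x \<psi>y algebra_simps)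
  then have \<tau>x: "\<tau> varX \<in> B1"
    using sh_B1[OF k'] by metis
  have \<tau>y: "\<tau> varY \<in> B1"
    unfolding \<tau>_def using sh_B1[of "\<gamma> * u"] \<gamma> \<theta>(4) by (simp add: \<psi>y)
  have "endo (varX + cst k * varY) varY (sh f) = f" for f
    unfolding sh_def endo_endo by simp
  then have "\<sigma> (\<tau> varY) = F"
    by (simp add: \<sigma>_def \<tau>_def F\<psi>)
  then show ?thesis
    using \<sigma> \<tau> \<sigma>x \<sigma>y \<tau>x \<tau>y by blast
qed

end

theorem theorem8:
  fixes U :: "'a::factorial_ring_gcd set"
    and p1 :: 'a and p2 :: "'a fract" and Q1 :: "'a poly" and Q2 :: "'a fract poly"
    and F :: "'a poly poly"
  assumes "assoc_reps U"
    and "(to_fract p1, p2, fract_poly Q1, Q2) \<in> L2_red U"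
    and "fract_poly2 F = quad_poly (to_fract p1) p2 (fract_poly Q1) Q2"
    and "F \<in> VA2"
  shows "(tame F \<longleftrightarrow>
            (\<exists>\<sigma>\<in>carrier GA2. \<exists>\<tau>\<in>carrier GA2.
               \<sigma> varX \<in> B1 \<and> \<sigma> varY \<in> B1 \<and> \<tau> varX \<in> B1 \<and> \<tau> varY \<in> B1 \<and>
               \<sigma> (\<tau> varY) = F)) \<and>
         (has_mate_of_length_1 F \<longleftrightarrow> (\<exists>u. u dvd 1 \<and> to_fract p1 * p2 = to_fract u)) \<and>
         (has_length_1_plus_1 F \<longleftrightarrow> phi p1 Q1 \<in> VA1 (quot_ring p1)) \<and>
         (tame F \<or> has_mate_of_length_1 F \<longrightarrow> has_length_1_plus_1 F)"
proof -
  from assms(2) obtain r q where L2: "(to_fract p1, p2, fract_poly Q1, Q2) \<in> L2"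
    and "poly (fract_poly Q1) 0 = 0"
    and "to_fract p1 = to_fract r" "fract_poly Q1 = fract_poly q" "gcd r (content q) = 1"
    unfolding L2_red_def by auto
  then have "gcd p1 (content Q1) = 1" and "poly Q1 0 = 0"
    by (simp_all add: poly_0_coeff_0 coeff_map_poly)
  moreover have "p1 \<noteq> 0" "p2 \<noteq> 0" "degree Q2 \<ge> 2"
    using L2 by (auto simp: L2_def)
  ultimately interpret reduced_quadruplet p1 p2 Q1 Q2 F
    using assms(3) by unfold_locales
  have tame: "tame F \<longleftrightarrow> (\<exists>\<sigma>\<in>carrier GA2. \<exists>\<tau>\<in>carrier GA2.
      \<sigma> varX \<in> B1 \<and> \<sigma> varY \<in> B1 \<and> \<tau> varX \<in> B1 \<and> \<tau> varY \<in> B1 \<and> \<sigma> (\<tau> varY) = F)"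
    (is "_ \<longleftrightarrow> ?B1")
  proof
    assume ?B1
    then obtain \<sigma> \<tau> where "\<sigma> \<in> TA2" "\<tau> \<in> TA2" "\<sigma> (\<tau> varY) = F"
      using B1_components_imp_tame by blast
    then have "\<sigma> \<circ> \<tau> \<in> TA2" "(\<sigma> \<circ> \<tau>) varY = F"
      using generate.eng[of \<sigma> GA2 _ \<tau>] by (auto simp: TA2_def)
    then show "tame F"
      unfolding tame_def by blast
  qed (rule tame_imp_B1_components)
  \<comment> \<open>The tame half of the fourth claim passes through the factorization of the
    first.\<close>
  moreover have "?B1 \<longrightarrow> has_length_1_plus_1 F"
    unfolding has_length_1_plus_1_def by blast
  ultimately show ?thesis
    using mate_imp_unit unit_imp_mate length_1_plus_1_imp_VA1 VA1_imp_length_1_plus_1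
      mate_imp_length_1_plus_1 assms(4) by blast
qed

end
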